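(* Let $\mu$ denote the standard normal distribution on $\mathbb{R}$, let $Y$ be a standard normally distributed random variable, and for $p\in\mathbb{N}$ let $Y^{(p)}=\Phi^{-1}\circ T^{(p)}\circ\Phi(Y)$. Then $$\operatorname{rbit}(\mu,p)\asymp 2^{-p/2}\cdot p^{-1/2}$$ and $$\left(\operatorname{E}|Y-Y^{(p)}|^2\right)^{1/2}\asymp \operatorname{rbit}(\mu,p),$$ both uniformly in $p\in\mathbb{N}$. Moreover, $\operatorname{E}(Y^{(p)})=0$ for every $p\in\mathbb{N}$, and $$\sup_{p\in\mathbb{N}}\operatorname{E}|Y^{(p)}|^r<\infty$$ for all $r\ge 1$.
   Context: $\mathbb{N}=\{1,2,\dots\}$. For functions $f,g\colon M\to[0,\infty]$ on a set $M$, $f(m)\preceq g(m)$ means that there is a constant $c>0$ with $f(m)\le c\,g(m)$ for every $m\in M$; $f\asymp g$ means $f\preceq g$ and $g\preceq f$. For a separable Banach space $(V,\|\cdot\|_V)$, $\mathfrak{M}(V)$ is the set of all Borel probability measures on $V$ with finite second moment, equipped with the Wasserstein distance of order two, $d(\mu_1,\mu_2)=\inf\{(\operatorname{E}\|X_1-X_2\|_V^2)^{1/2}\colon P_{X_1}=\mu_1,\ P_{X_2}=\mu_2\}$, where $X_1,X_2$ are $V$-valued, jointly defined on any probability space, and $P_{X_i}$ denotes the distribution of $X_i$. For $p\in\mathbb{N}$, $\mathfrak{R}(V,p)\subseteq\mathfrak{M}(V)$ is the set of all image measures of the uniform distribution on $\{0,1\}^p$ under maps $f\colon\{0,1\}^p\to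 V$ (equivalently, all probability measures with support of size at most $2^p$ and with weights that are integer multiples of $2^{-p}$). For $\mu\in\mathfrak{M}(V)$ put $\operatorname{rbit}(\mu,p)=\inf\{d(\mu,\nu)\colon\nu\in\mathfrak{R}(V,p)\}$. Here $V=\mathbb{R}$. $\Phi$ is the distribution function of the standard normal distribution, $\Phi^{-1}\colon{]0,1[}\to\mathbb{R}$ its inverse. For $p\in\mathbb{N}$, $D^{(p)}=\{k\cdot 2^{-p}-2^{-(p+1)}\colon k=1,\dots,2^p\}$ and $T^{(p)}\colon[0,1[\,\to D^{(p)}$, $T^{(p)}(x)=\lfloor 2^p x\rfloor/2^p+2^{-(p+1)}$. *)

theory Defs
  imports "HOL-Probability.Probability"
begin

definition preceq_on :: "'m set \<Rightarrow> ('m \<Rightarrow> real) \<Rightarrow> ('m \<Rightarrow> real) \<Rightarrow> bool" where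
  "preceq_on A f g \<longleftrightarrow> (\<exists>c>0. \<forall>m\<in>A. f m \<le> c * g m)"

definition weakly_equiv_on :: "'m set \<Rightarrow> ('m \<Rightarrow> real) \<Rightarrow> ('m \<Rightarrow> real) \<Rightarrow> bool" where
  "weakly_equiv_on A f g \<longleftrightarrow> preceq_on A f g \<and> preceq_on A g f"


definition second_moment_measures ::
    "'v::{banach, second_countable_topology} measure set" where
  "second_moment_measures =
    {\<mu>. prob_space \<mu> \<and> sets \<mu> = sets borel \<and> integrable \<mu> (\<lambda>x. (norm x)\<^sup>2)}"

text \<open>
  The two random variables may live on any probability space. Quantifying over spaces
  with underlying type \<^typ>\<open>'w\<close> is written with an explicit type argument; the distance uses
  the underlying type \<^typ>\<open>'v \<times> 'v\<close>, and \<open>coupling_costs_subset\<close> below shows that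
  no other choice yields further values.
\<close>

definition coupling_costs ::
    "'w itself \<Rightarrow> 'v::{banach, second_countable_topology} measure \<Rightarrow> 'v measure \<Rightarrow> real set" where
  "coupling_costs _ \<mu>1 \<mu>2 =
    {sqrt (prob_space.expectation M (\<lambda>\<omega>. (norm (X1 \<omega> - X2 \<omega>))\<^sup>2)) | (M :: 'w measure) X1 X2.
       prob_space M \<and> X1 \<in> borel_measurable M \<and> X2 \<in> borel_measurable M \<and>
       distr M borel X1 = \<mu>1 \<and> distr M borel X2 = \<mu>2}"

definition wasserstein2 ::
    "'v::{banach, second_countable_topology} measure \<Rightarrow> 'v measure \<Rightarrow> real" where
  "wasserstein2 \<mu>1 \<mu>2 = Inf (coupling_costs TYPE('v \<times> 'v) \<mu>1 \<mu>2)"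

definition random_bit_measures ::
    "nat \<Rightarrow> 'v::{banach, second_countable_topology} measure set" where
  "random_bit_measures p =
    {distr (uniform_count_measure ({1..p} \<rightarrow>\<^sub>E {0, 1::nat})) borel f | f. True}"

definition rbit :: "'v::{banach, second_countable_topology} measure \<Rightarrow> nat \<Rightarrow> real" where
  "rbit \<mu> p = Inf {wasserstein2 \<mu> \<nu> | \<nu>. \<nu> \<in> random_bit_measures p}"


abbreviation std_normal_cdf :: "real \<Rightarrow> real" where
  "std_normal_cdf \<equiv> cdf std_normal_distribution"

definition bit_round :: "nat \<Rightarrow> real \<Rightarrow> real" where
  "bit_round p x = real_of_int \<lfloor>2 ^ p * x\<rfloor> / 2 ^ p + 1 / 2 ^ (p + 1)"

text \<open>
  Since \<^term>\<open>std_normal_cdf\<close> is a bijection from the reals onto \<open>]0,1[\<close>, the value of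
  \<^term>\<open>inv std_normal_cdf\<close> at a point of \<open>]0,1[\<close>, which includes the range of
  \<^term>\<open>bit_round p\<close> on \<open>[0,1[\<close>, is the value of the inverse function.
\<close>

definition bit_approx :: "nat \<Rightarrow> ('a \<Rightarrow> real) \<Rightarrow> 'a \<Rightarrow> real" where
  "bit_approx p Y = inv std_normal_cdf \<circ> bit_round p \<circ> std_normal_cdf \<circ> Y"


text \<open>
  On \<^const>\<open>second_moment_measures\<close> the real-valued expectations and infima above are never
  taken over non-integrable functions or empty sets.
\<close>

lemma coupling_integrable:
  fixes X1 X2 :: "'w \<Rightarrow> 'v::{banach, second_countable_topology}"
  assumes [measurable]: "X1 \<in> borel_measurable M" "X2 \<in> borel_measurable M"
    and "distr M borel X1 \<in> second_moment_measures" "distr M borel X2 \<in> second_moment_measures"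
  shows "integrable M (\<lambda>\<omega>. (norm (X1 \<omega> - X2 \<omega>))\<^sup>2)"
proof (rule Bochner_Integration.integrable_bound)
  have "integrable M (\<lambda>\<omega>. (norm (X1 \<omega>))\<^sup>2)" "integrable M (\<lambda>\<omega>. (norm (X2 \<omega>))\<^sup>2)"
    using assms(3,4) by (auto simp: second_moment_measures_def integrable_distr_eq)
  then show "integrable M (\<lambda>\<omega>. 2 * (norm (X1 \<omega>))\<^sup>2 + 2 * (norm (X2 \<omega>))\<^sup>2)"
    by auto
  have "(norm (x - y))\<^sup>2 \<le> 2 * (norm x)\<^sup>2 + 2 * (norm y)\<^sup>2" for x y :: 'v
  proof -
    have "(norm (x - y))\<^sup>2 \<le> (norm x + norm y)\<^sup>2"
      by (intro power_mono norm_triangle_ineq4) auto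
    also have "\<dots> \<le> 2 * (norm x)\<^sup>2 + 2 * (norm y)\<^sup>2"
      using zero_le_power2[of "norm x - norm y"] by (simp add: power2_eq_square algebra_simps)
    finally show ?thesis .
  qed
  then show "AE \<omega> in M. norm ((norm (X1 \<omega> - X2 \<omega>))\<^sup>2)
      \<le> norm (2 * (norm (X1 \<omega>))\<^sup>2 + 2 * (norm (X2 \<omega>))\<^sup>2)"
    by auto
qed measurable

lemma coupling_costs_subset:
  fixes \<mu>1 \<mu>2 :: "'v::{banach, second_countable_topology} measure"
  shows "coupling_costs TYPE('w) \<mu>1 \<mu>2 \<subseteq> coupling_costs TYPE('v \<times> 'v) \<mu>1 \<mu>2"
proof
  fix c assume "c \<in> coupling_costs TYPE('w) \<mu>1 \<mu>2"
  then obtain M :: "'w measure" and X1 X2 where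
    c: "c = sqrt (prob_space.expectation M (\<lambda>\<omega>. (norm (X1 \<omega> - X2 \<omega>))\<^sup>2))"
    and M: "prob_space M"
    and [measurable]: "X1 \<in> borel_measurable M" "X2 \<in> borel_measurable M"
    and d: "distr M borel X1 = \<mu>1" "distr M borel X2 = \<mu>2"
    unfolding coupling_costs_def by auto
  let ?N = "distr M (borel \<Otimes>\<^sub>M borel) (\<lambda>\<omega>. (X1 \<omega>, X2 \<omega>))"
  have "prob_space ?N"
    using M by (rule prob_space.prob_space_distr) measurable
  moreover have "distr ?N borel fst = \<mu>1" "distr ?N borel snd = \<mu>2"
    using d by (subst distr_distr; simp add: comp_def)+
  moreover have "c = sqrt (prob_space.expectation ?N (\<lambda>\<omega>. (norm (fst \<omega> - snd \<omega>))\<^sup>2))"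
    unfolding c by (subst integral_distr) auto
  moreover have "fst \<in> borel_measurable ?N" "snd \<in> borel_measurable ?N"
    by auto
  ultimately show "c \<in> coupling_costs TYPE('v \<times> 'v) \<mu>1 \<mu>2"
    unfolding coupling_costs_def by blast
qed

lemma coupling_costs_nonempty:
  fixes \<mu>1 \<mu>2 :: "'v::{banach, second_countable_topology} measure"
  assumes "\<mu>1 \<in> second_moment_measures" "\<mu>2 \<in> second_moment_measures"
  shows "coupling_costs TYPE('v \<times> 'v) \<mu>1 \<mu>2 \<noteq> {}"
proof -
  interpret m1: prob_space \<mu>1 using assms by (simp add: second_moment_measures_def)
  interpret m2: prob_space \<mu>2 using assms by (simp add: second_moment_measures_def)
  interpret pair_prob_space \<mu>1 \<mu>2 ..
  have s[measurable_cong]: "sets \<mu>1 = sets borel" "sets \<mu>2 = sets borel"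
    using assms by (simp_all add: second_moment_measures_def)
  have "distr (\<mu>1 \<Otimes>\<^sub>M \<mu>2) borel fst = distr (\<mu>1 \<Otimes>\<^sub>M \<mu>2) \<mu>1 fst"
    "distr (\<mu>1 \<Otimes>\<^sub>M \<mu>2) borel snd = distr (\<mu>1 \<Otimes>\<^sub>M \<mu>2) \<mu>2 snd"
    using s by (auto intro!: distr_cong)
  moreover have "distr (\<mu>1 \<Otimes>\<^sub>M \<mu>2) \<mu>1 fst = \<mu>1"
    by (simp add: m2.distr_pair_fst m2.emeasure_space_1 scale_measure_1)
  moreover have "distr (\<mu>1 \<Otimes>\<^sub>M \<mu>2) \<mu>2 snd = \<mu>2"
  proof (rule measure_eqI)
    fix A assume "A \<in> sets (distr (\<mu>1 \<Otimes>\<^sub>M \<mu>2) \<mu>2 snd)"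
    then have A: "A \<in> sets \<mu>2" by simp
    have "snd -` A \<inter> space (\<mu>1 \<Otimes>\<^sub>M \<mu>2) = space \<mu>1 \<times> A"
      using sets.sets_into_space[OF A] by (auto simp: space_pair_measure)
    then show "emeasure (distr (\<mu>1 \<Otimes>\<^sub>M \<mu>2) \<mu>2 snd) A = emeasure \<mu>2 A"
      using A by (simp add: emeasure_distr m2.emeasure_pair_measure_Times m1.emeasure_space_1)
  qed simp
  moreover have "fst \<in> borel_measurable (\<mu>1 \<Otimes>\<^sub>M \<mu>2)" "snd \<in> borel_measurable (\<mu>1 \<Otimes>\<^sub>M \<mu>2)"
    by measurable
  ultimately show ?thesis
    using prob_space_axioms unfolding coupling_costs_def by fastforce
qed

lemma random_bit_measures_subset:
  "random_bit_measures p \<subseteq>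
    (second_moment_measures :: 'v::{banach, second_countable_topology} measure set)"
proof -
  let ?U = "uniform_count_measure ({1..p} \<rightarrow>\<^sub>E {0, 1::nat})"
  have fin: "finite ({1..p} \<rightarrow>\<^sub>E {0, 1::nat})" "({1..p} \<rightarrow>\<^sub>E {0, 1::nat}) \<noteq> {}"
    by (auto intro: finite_PiE simp: PiE_eq_empty_iff)
  have m: "f \<in> borel_measurable ?U" for f :: "(nat \<Rightarrow> nat) \<Rightarrow> 'v"
    by (auto simp: measurable_def sets_uniform_count_measure space_uniform_count_measure)
  have "prob_space (distr ?U borel f)" for f :: "(nat \<Rightarrow> nat) \<Rightarrow> 'v"
    using prob_space.prob_space_distr[OF prob_space_uniform_count_measure[OF fin] m] .
  moreover have "integrable (distr ?U borel f) (\<lambda>x. (norm x)\<^sup>2)" for f :: "(nat \<Rightarrow> nat) \<Rightarrow> 'v"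
    using fin(1) m by (simp add: integrable_distr_eq uniform_count_measure_def integrable_point_measure_finite)
  ultimately show ?thesis
    by (auto simp: random_bit_measures_def second_moment_measures_def)
qed

end

theory Submission
  imports Defs "HOL-Real_Asymp.Real_Asymp"
begin

text \<open>
  Let \<open>\<phi>\<close>, \<open>\<Phi>\<close> and \<open>q\<close> be the standard normal density, distribution function and quantile function,
  let \<open>N\<close> be the \<open>p\<close>-th power of \<open>2\<close>, and let \<open>e\<close> be the root mean square distance between \<open>Y\<close> and its
  rounding \<open>Y'\<close> to \<open>p\<close> bits. Both equivalences follow from the cyclic chain of estimates
  \<open>(N p) powr (-1/2) \<preceq> rbit \<le> e \<preceq> (N p) powr (-1/2)\<close>. The quantity that controls both ends of it is the
  reversed hazard rate \<open>k = \<phi> / \<Phi>\<close>. It is the derivative of \<open>ln \<Phi>\<close>, it is decreasing, and in the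
  left tail its square is of the order of \<open>1 + ln (1 / \<Phi>)\<close>.

  The middle inequality holds because \<open>\<Phi>(Y)\<close> is uniform on the unit interval, so that \<open>Y'\<close> takes each
  of the values \<open>q((j - 1/2) / N)\<close> with probability \<open>1 / N\<close>. Hence its law is the image of \<open>p\<close> random
  bits (\<open>bit_rounded_value_distr_random_bits\<close>), and \<open>(Y, Y')\<close> is one of the couplings over which the
  Wasserstein distance is the infimum. The symmetry \<open>q(1 - u) = - q(u)\<close> of these values gives
  \<open>E Y' = 0\<close>.

  For the upper bound, let \<open>u\<close> lie in the \<open>j\<close>-th cell, \<open>j \<le> N / 2\<close>. Monotonicity of \<open>k\<close> bounds the
  distance of \<open>q(u)\<close> from the right end \<open>q(j / N)\<close> by \<open>ln (j / (N u)) / k\<close>, with \<open>k\<close> taken at that right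
  end, where its square is at least a constant times \<open>1 + ln (N / j)\<close>. As
  \<open>(1 + ln (N / j)) (1 + ln j) \<ge> 1 + ln N\<close>, the dependence on \<open>p\<close> splits off as the factor
  \<open>1 / (1 + ln N)\<close>, and the squared error is at most this factor times \<open>w(N u)\<close> for a function \<open>w\<close> that is
  integrable on the half line and does not depend on \<open>p\<close> (\<open>midpoint_cell_error\<close>). The substitution
  \<open>v = N u\<close> then produces the factor \<open>1 / N\<close>. The unbounded extreme cells need no separate treatment:
  there \<open>w\<close> only has an integrable singularity at \<open>0\<close>.

  For the lower bound, any law of \<open>p\<close> random bits gives each half line either no mass or mass at least
  \<open>1 / N\<close>, whereas \<open>\<Phi>\<close> passes from \<open>1 / (4 N)\<close> to \<open>3 / (4 N)\<close> between \<open>s = q(1 / (4 N))\<close> and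
  \<open>t = q(3 / (4 N))\<close>. So in every coupling a mass of at least \<open>1 / (4 N)\<close> has to be moved over half the
  distance from \<open>s\<close> to \<open>t\<close> (\<open>quantized_coupling_lower_bound\<close>), and \<open>t - s\<close> is at least a constant times
  \<open>1 / k(t)\<close>, hence at least a constant times \<open>p powr (-1/2)\<close> (\<open>std_normal_quantile_tail_gap\<close>).

  For the moments, \<open>T(u) \<ge> u / 2\<close> for the cell midpoint \<open>T(u)\<close> of \<open>u\<close>, and the Gaussian tail bound turns
  this and its mirror image into a bound on \<open>exp (q(T(u))\<^sup>2 / 4)\<close> by an integrable function that does not
  depend on \<open>p\<close>.
\<close>

section \<open>The standard normal distribution function and its reversed hazard rate\<close>

interpretation std_normal: cdf_distribution std_normal_distribution
  unfolding cdf_distribution_def by (rule real_dist_normal_dist)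

lemma std_normal_density_has_derivative:
  "(std_normal_density has_real_derivative - x * std_normal_density x) (at x)"
  unfolding std_normal_density_def[abs_def]
  by (auto intro!: derivative_eq_intros simp: real_div_sqrt field_simps)

lemma continuous_on_std_normal_density: "continuous_on A std_normal_density"
  by (meson DERIV_isCont continuous_at_imp_continuous_on std_normal_density_has_derivative)

lemma std_normal_cdf_diff_has_integral:
  assumes "a \<le> b"
  shows "(std_normal_density has_integral (std_normal_cdf b - std_normal_cdf a)) {a..b}"
proof (cases "a = b")
  case False
  then have "a < b" using assms by simp
  have int: "integrable lborel std_normal_density"
    using integrable_std_normal_moment[of 0] by simp
  have "std_normal_cdf b - std_normal_cdf a = measure std_normal_distribution {a<..b}"
    using \<open>a < b\<close> by (rule std_normal.cdf_diff_eq)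
  also have "\<dots> = (\<integral>x. indicator {a<..b} x \<partial>std_normal_distribution)"
    by simp
  also have "\<dots> = (\<integral>x. std_normal_density x *\<^sub>R indicator {a<..b} x \<partial>lborel)"
    by (rule integral_density; measurable)
  also have "\<dots> = (\<integral>x. indicator {a..b} x *\<^sub>R std_normal_density x \<partial>lborel)"
    by (rule integral_cong_AE; (measurable)?; rule AE_mp[OF AE_lborel_singleton[of a]], rule AE_I2)
       (auto simp: indicator_def)
  finally have eq: "std_normal_cdf b - std_normal_cdf a = (LINT x:{a..b}|lborel. std_normal_density x)"
    by (simp add: set_lebesgue_integral_def)
  have "set_integrable lborel {a..b} std_normal_density"
    unfolding set_integrable_def by (rule integrable_mult_indicator[OF _ int]) simp
  then show ?thesis
    unfolding eq by (simp add: has_integral_iff set_borel_integral_eq_integral)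
qed (simp add: has_integral_refl)

lemma std_normal_cdf_has_derivative:
  "(std_normal_cdf has_real_derivative std_normal_density x) (at x)"
proof -
  have "((\<lambda>t. integral {x - 1..t} std_normal_density) has_real_derivative std_normal_density x)
      (at x within {x - 1..x + 1})"
    by (rule integral_has_real_derivative) (auto intro: continuous_on_std_normal_density)
  then have "((\<lambda>t. std_normal_cdf (x - 1) + integral {x - 1..t} std_normal_density)
      has_real_derivative 0 + std_normal_density x) (at x)"
    by (intro DERIV_add DERIV_const) (simp add: at_within_Icc_at)
  then have "(std_normal_cdf has_real_derivative 0 + std_normal_density x) (at x)"
  proof (rule has_field_derivative_transform_within[where d = 1])
    fix t assume "dist t x < 1"
    then have "x - 1 \<le> t" by (auto simp: dist_real_def)
    from std_normal_cdf_diff_has_integral[OF this]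
    show "std_normal_cdf (x - 1) + integral {x - 1..t} std_normal_density = std_normal_cdf t"
      by (simp add: has_integral_iff)
  qed simp_all
  then show ?thesis by simp
qed

lemma isCont_std_normal_cdf: "isCont std_normal_cdf x"
  using std_normal_cdf_has_derivative by (rule DERIV_isCont)

lemma std_normal_cdf_less: "x < y \<Longrightarrow> std_normal_cdf x < std_normal_cdf y"
  by (rule DERIV_pos_imp_increasing)
     (auto intro!: exI std_normal_cdf_has_derivative normal_density_pos)

lemma std_normal_cdf_less_iff [simp]: "std_normal_cdf x < std_normal_cdf y \<longleftrightarrow> x < y"
  by (metis linorder_neqE_linordered_idom not_less_iff_gr_or_eq std_normal_cdf_less)

lemma std_normal_cdf_le_iff [simp]: "std_normal_cdf x \<le> std_normal_cdf y \<longleftrightarrow> x \<le> y"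
  using std_normal_cdf_less_iff[of y x] by (simp only: not_less[symmetric])

lemma std_normal_cdf_eq_iff [simp]: "std_normal_cdf x = std_normal_cdf y \<longleftrightarrow> x = y"
  by (simp add: order_eq_iff)

lemma std_normal_cdf_pos: "0 < std_normal_cdf x"
  using std_normal_cdf_less[of "x - 1" x] std_normal.cdf_nonneg[of "x - 1"] by linarith

text \<open>
  Both sides have the same derivative, and they agree in the limit at infinity.
\<close>

lemma std_normal_cdf_minus: "std_normal_cdf (- x) = 1 - std_normal_cdf x"
proof -
  let ?S = "\<lambda>x. std_normal_cdf x + std_normal_cdf (- x)"
  have "(?S has_real_derivative 0) (at x)" for x
    by (auto intro!: derivative_eq_intros DERIV_chain2[OF std_normal_cdf_has_derivative]
        std_normal_cdf_has_derivative simp: std_normal_density_def[of x] std_normal_density_def[of "- x"])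
  then have const: "?S y = ?S x" for y
    by (intro DERIV_const_ratio_const[of _ _ ?S] DERIV_isconst_all) auto
  have "(?S \<longlongrightarrow> 1 + 0) at_top"
    by (intro tendsto_add std_normal.cdf_lim_at_top_prob
        filterlim_compose[OF std_normal.cdf_lim_at_bot] filterlim_uminus_at_bot_at_top)
  moreover have "(?S \<longlongrightarrow> ?S x) at_top"
    by (subst const) auto
  ultimately have "?S x = 1 + 0"
    using tendsto_unique trivial_limit_at_top_linorder by blast
  then show ?thesis by simp
qed

lemma std_normal_cdf_0: "std_normal_cdf 0 = 1 / 2"
  using std_normal_cdf_minus[of 0] by simp

lemma std_normal_cdf_surj:
  assumes "0 < u" "u < 1"
  obtains x where "std_normal_cdf x = u"
proof -
  obtain a where a: "std_normal_cdf a < u"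
    using order_tendstoD(2)[OF std_normal.cdf_lim_at_bot assms(1)]
    by (meson eventually_happens' trivial_limit_at_bot_linorder)
  obtain b where b: "u < std_normal_cdf b"
    using order_tendstoD(1)[OF std_normal.cdf_lim_at_top_prob assms(2)]
    by (meson eventually_happens' trivial_limit_at_top_linorder)
  have "a \<le> b" using less_trans[OF a b] by simp
  from IVT[of std_normal_cdf a u b, OF _ _ this] a b isCont_std_normal_cdf show thesis
    using that by (auto simp: less_imp_le)
qed

text \<open>
  The ratio \<open>\<phi> / \<Phi>\<close>, the logarithmic derivative of \<open>\<Phi>\<close>. At \<open>- x\<close> it is the hazard rate (the
  inverse of the Mills ratio) of the normal distribution at \<open>x\<close>.
\<close>

definition reversed_hazard :: "real \<Rightarrow> real" where
  "reversed_hazard y = std_normal_density y / std_normal_cdf y"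

lemma reversed_hazard_pos: "0 < reversed_hazard y"
  by (simp add: reversed_hazard_def std_normal_cdf_pos normal_density_pos)

lemma std_normal_cdf_eq: "std_normal_cdf y = std_normal_density y / reversed_hazard y"
  using std_normal_cdf_pos[of y] normal_density_pos[of 1 0 y]
  by (auto simp: reversed_hazard_def field_simps)

text \<open>
  This is the classical tail bound \<open>\<Phi>(y) \<le> \<phi>(y) / \<bar>y\<bar>\<close> for \<open>y < 0\<close>: the function
  \<open>\<Phi>(x) + \<phi>(x) / x\<close> vanishes at minus infinity and decreases on the negative half line.
\<close>

lemma reversed_hazard_lower: "- y \<le> reversed_hazard y"
proof (cases "y < 0")
  case True
  let ?D = "\<lambda>x. std_normal_cdf x + std_normal_density x / x"
  have der: "(?D has_real_derivative - std_normal_density x / x\<^sup>2) (at x)" if "x < 0" for x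
    using that
    by (auto intro!: derivative_eq_intros std_normal_cdf_has_derivative
        std_normal_density_has_derivative simp: field_simps power2_eq_square)
  have dec: "?D y \<le> ?D x" if "x \<le> y" for x
  proof (rule DERIV_nonpos_imp_nonincreasing[OF that])
    fix z assume "z \<le> y"
    then show "\<exists>d. (?D has_real_derivative d) (at z) \<and> d \<le> 0"
      using True by (intro exI conjI) (rule der, auto simp: normal_density_nonneg)
  qed
  have "((\<lambda>x. std_normal_density x / x) \<longlongrightarrow> 0) at_bot"
    unfolding std_normal_density_def[abs_def] by real_asymp
  then have "(?D \<longlongrightarrow> 0 + 0) at_bot"
    by (intro tendsto_add std_normal.cdf_lim_at_bot)
  then have "?D y \<le> 0"
    by (intro tendsto_lowerbound[where f = ?D and F = at_bot])
       (auto intro: eventually_mono[OF eventually_le_at_bot[of y]] dec)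
  then show ?thesis
    using True std_normal_cdf_pos[of y] by (simp add: reversed_hazard_def field_simps)
next
  case False
  then show ?thesis using reversed_hazard_pos[of y] by linarith
qed

text \<open>
  The logarithmic derivative of \<open>k = \<phi> / \<Phi>\<close> is \<open>- (z + k(z))\<close>, so monotonicity is equivalent to the
  preceding tail bound.
\<close>

lemma reversed_hazard_antimono:
  assumes "x \<le> y"
  shows "reversed_hazard y \<le> reversed_hazard x"
proof (rule DERIV_nonpos_imp_nonincreasing[OF assms])
  fix z
  have "(reversed_hazard has_real_derivative - reversed_hazard z * (z + reversed_hazard z)) (at z)"
    unfolding reversed_hazard_def[abs_def]
    using std_normal_cdf_pos[of z]
    by (auto intro!: derivative_eq_intros std_normal_cdf_has_derivative
        std_normal_density_has_derivative simp: field_simps)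
  moreover have "- reversed_hazard z * (z + reversed_hazard z) \<le> 0"
    using reversed_hazard_pos[of z] reversed_hazard_lower[of z] by (simp add: mult_nonneg_nonneg)
  ultimately show "\<exists>d. (reversed_hazard has_real_derivative d) (at z) \<and> d \<le> 0"
    by blast
qed

lemma reversed_hazard_0_ge: "3 / 4 \<le> reversed_hazard 0"
proof -
  have "pi \<le> 4 * (8/9)" using pi_less_4 pi_approx by simp
  then have "sqrt (2 * pi) \<le> sqrt ((8/3)\<^sup>2)"
    by (intro real_sqrt_le_mono) (simp add: power2_eq_square)
  then have "sqrt (2 * pi) \<le> 8/3" by simp
  then show ?thesis
    by (simp add: reversed_hazard_def std_normal_cdf_0 std_normal_density_def[of 0] field_simps)
qed

lemma reversed_hazard_ge:
  assumes "y \<le> 0"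
  shows "3 / 4 \<le> reversed_hazard y"
  using reversed_hazard_0_ge reversed_hazard_antimono[OF assms] by linarith

text \<open>
  As \<open>1 / \<Phi> = k / \<phi>\<close>, its logarithm is \<open>ln k(y) + y\<^sup>2 / 2\<close> up to a constant. Here \<open>y\<^sup>2 \<le> k(y)\<^sup>2\<close>, and the
  remaining terms are absorbed because \<open>k\<close> is bounded away from \<open>0\<close> on the negative half line.
\<close>

lemma ln_inverse_std_normal_cdf_le:
  assumes "y \<le> 0"
  shows "1 + ln (1 / std_normal_cdf y) \<le> 8 * (reversed_hazard y)\<^sup>2"
proof -
  let ?k = "reversed_hazard y"
  have k: "3 / 4 \<le> ?k" by (rule reversed_hazard_ge[OF assms])
  have "1 / std_normal_cdf y = ?k * sqrt (2 * pi) * exp (y\<^sup>2 / 2)"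
    by (simp add: std_normal_cdf_eq[of y] std_normal_density_def[of y] exp_minus field_simps)
  then have "ln (1 / std_normal_cdf y) = ln ?k + ln (sqrt (2 * pi)) + y\<^sup>2 / 2"
    using k by (simp add: ln_mult)
  also have "ln ?k \<le> ?k - 1" using k by (intro ln_le_minus_one) simp
  also have "ln (sqrt (2 * pi)) \<le> 2"
  proof -
    have "sqrt (2 * pi) \<le> sqrt (3\<^sup>2)"
      using pi_less_4 by (intro real_sqrt_le_mono) (simp add: power2_eq_square)
    then show ?thesis using ln_le_minus_one[of "sqrt (2 * pi)"] by simp
  qed
  also have "y\<^sup>2 / 2 \<le> ?k\<^sup>2 / 2"
    using reversed_hazard_lower[of y] assms by (auto intro!: power2_mono simp: abs_le_square_iff[symmetric])
  finally have "1 + ln (1 / std_normal_cdf y) \<le> ?k + 2 + ?k\<^sup>2 / 2" by simp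
  also have "\<dots> \<le> 8 * ?k\<^sup>2"
  proof -
    have "(3/4) * ?k \<le> ?k * ?k" "(3/4) * (3/4) \<le> ?k * ?k"
      using k by (intro mult_mono; simp)+
    then show ?thesis by (simp add: power2_eq_square)
  qed
  finally show ?thesis .
qed

text \<open>
  By monotonicity, the denominator of \<open>\<Phi> = \<phi> / k\<close> may be replaced by \<open>k(0)\<close>.
\<close>

lemma std_normal_cdf_le_exp:
  assumes "y \<le> 0"
  shows "std_normal_cdf y \<le> exp (- y\<^sup>2 / 2) / 2"
proof -
  have "std_normal_cdf y \<le> std_normal_density y / reversed_hazard 0"
    unfolding std_normal_cdf_eq using reversed_hazard_pos reversed_hazard_antimono[OF assms]
    by (intro divide_left_mono) (auto simp: normal_density_nonneg)
  also have "\<dots> = exp (- y\<^sup>2 / 2) / 2"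
    by (simp add: reversed_hazard_def std_normal_cdf_0 std_normal_density_def[of 0]
        std_normal_density_def[of y] field_simps)
  finally show ?thesis .
qed

text \<open>
  A lower bound for \<open>\<Phi>(y)\<close>: on an interval of length \<open>1 / (1 + \<bar>y\<bar>)\<close> to the left of \<open>y\<close>, the square of
  the argument grows by at most \<open>3\<close>, so the density stays above \<open>exp (- 3 / 2) \<phi>(y)\<close>.
\<close>

lemma reversed_hazard_upper:
  assumes "y \<le> 0"
  shows "reversed_hazard y \<le> exp (3 / 2) * (1 - y)"
proof -
  define d where "d = 1 / (1 - y)"
  have d: "0 < d" "d \<le> 1" using assms by (auto simp: d_def)
  have yd: "- y * d \<le> 1" using assms by (simp add: d_def field_simps)
  obtain z where z: "y - d < z" "z < y"
    "std_normal_cdf y - std_normal_cdf (y - d) = (y - (y - d)) * std_normal_density z"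
    using MVT2[of "y - d" y std_normal_cdf std_normal_density] d
    by (auto intro: std_normal_cdf_has_derivative)
  have "z\<^sup>2 \<le> (y - d)\<^sup>2"
    using z(1,2) assms by (simp add: abs_le_square_iff[symmetric])
  also have "\<dots> \<le> y\<^sup>2 + 3"
    using yd d mult_mono[of d 1 d 1] by (simp add: power2_eq_square algebra_simps)
  finally have "- (3 / 2) + - y\<^sup>2 / 2 \<le> - z\<^sup>2 / 2" by simp
  then have "exp (- (3 / 2)) * exp (- y\<^sup>2 / 2) \<le> exp (- z\<^sup>2 / 2)"
    unfolding mult_exp_exp exp_le_cancel_iff .
  then have "exp (- (3 / 2)) * std_normal_density y \<le> std_normal_density z"
    by (simp add: std_normal_density_def[of y] std_normal_density_def[of z] divide_right_mono)
  then have "d * (exp (- (3 / 2)) * std_normal_density y) \<le> d * std_normal_density z"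
    using d by (intro mult_left_mono) auto
  also have "\<dots> = std_normal_cdf y - std_normal_cdf (y - d)"
    using z(3) by simp
  also have "\<dots> \<le> std_normal_cdf y"
    using std_normal_cdf_pos[of "y - d"] by linarith
  finally show ?thesis
    using assms std_normal_cdf_pos[of y]
    by (simp add: reversed_hazard_def d_def exp_minus field_simps)
qed

text \<open>
  Mean value theorem for \<open>ln \<Phi>\<close>, whose derivative on the interval from \<open>y\<close> to \<open>a\<close> is at least its value
  at the right end. Being only logarithmic in \<open>\<Phi>(y)\<close>, the bound stays square integrable over the extreme
  cell, on which \<open>y\<close> is unbounded.
\<close>

lemma std_normal_quantile_gap_le:
  assumes "y \<le> a"
  shows "a - y \<le> ln (std_normal_cdf a / std_normal_cdf y) / reversed_hazard a"
proof (cases "y = a")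
  case False
  then have "y < a" using assms by simp
  have der: "((\<lambda>x. ln (std_normal_cdf x)) has_real_derivative reversed_hazard x) (at x)" for x
    using std_normal_cdf_pos[of x]
    by (auto intro!: derivative_eq_intros std_normal_cdf_has_derivative simp: reversed_hazard_def)
  obtain z where z: "y < z" "z < a"
    "ln (std_normal_cdf a) - ln (std_normal_cdf y) = (a - y) * reversed_hazard z"
    using MVT2[OF \<open>y < a\<close> der] by auto
  have "(a - y) * reversed_hazard a \<le> (a - y) * reversed_hazard z"
    using \<open>y < a\<close> z by (intro mult_left_mono reversed_hazard_antimono) auto
  then show ?thesis
    using z(3) reversed_hazard_pos[of a] std_normal_cdf_pos[of a] std_normal_cdf_pos[of y]
    by (simp add: ln_div pos_le_divide_eq)
qed simp

section \<open>The quantile function and the error of rounding to cell midpoints\<close>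

abbreviation std_normal_quantile :: "real \<Rightarrow> real" where
  "std_normal_quantile \<equiv> inv std_normal_cdf"

lemma std_normal_quantile_cdf [simp]: "std_normal_quantile (std_normal_cdf x) = x"
  by (rule inv_f_f) (simp add: inj_def)

lemma std_normal_cdf_quantile:
  assumes "0 < u" "u < 1"
  shows "std_normal_cdf (std_normal_quantile u) = u"
  by (metis assms std_normal_cdf_surj std_normal_quantile_cdf)

lemma std_normal_quantile_le_iff:
  assumes "0 < u" "u < 1" "0 < v" "v < 1"
  shows "std_normal_quantile u \<le> std_normal_quantile v \<longleftrightarrow> u \<le> v"
  using std_normal_cdf_le_iff[of "std_normal_quantile u" "std_normal_quantile v"] assms
  by (simp only: std_normal_cdf_quantile)

lemma std_normal_quantile_minus:
  assumes "0 < u" "u < 1"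
  shows "std_normal_quantile (1 - u) = - std_normal_quantile u"
  by (metis assms std_normal_cdf_minus std_normal_cdf_quantile std_normal_quantile_cdf)

lemma std_normal_quantile_nonpos:
  assumes "0 < u" "u \<le> 1 / 2"
  shows "std_normal_quantile u \<le> 0"
proof -
  have "std_normal_quantile u \<le> std_normal_quantile (std_normal_cdf 0)"
    using assms by (subst std_normal_quantile_le_iff) (auto simp: std_normal_cdf_0)
  then show ?thesis by simp
qed

text \<open>
  The oscillation of the quantile function below a level \<open>b\<close>, measured by the relative distance of the
  arguments from \<open>b\<close>. The denominator, which the reversed hazard rate at \<open>b\<close> contributes, is the source
  of the factor \<open>1 / p\<close> in the mean square error.
\<close>

lemma std_normal_quantile_oscillation:
  assumes "b \<le> 1 / 2" "0 < v1" "v1 \<le> b" "0 < v2" "v2 \<le> b"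
    and "ln (b / v1) \<le> L" "ln (b / v2) \<le> L"
  shows "(std_normal_quantile v1 - std_normal_quantile v2)\<^sup>2 \<le> 8 * L\<^sup>2 / (1 + ln (1 / b))"
proof -
  let ?q = std_normal_quantile
  let ?k = "reversed_hazard (?q b)"
  have b: "0 < b" "b < 1" using assms by auto
  have gap: "0 \<le> ?q b - ?q v \<and> ?q b - ?q v \<le> L / ?k"
    if v: "0 < v" "v \<le> b" "ln (b / v) \<le> L" for v
  proof -
    have le: "?q v \<le> ?q b" using v b by (subst std_normal_quantile_le_iff) auto
    have "?q b - ?q v \<le> ln (b / v) / ?k"
      using std_normal_quantile_gap_le[OF le] v b by (simp add: std_normal_cdf_quantile)
    also have "\<dots> \<le> L / ?k"
      using v(3) reversed_hazard_pos[of "?q b"] by (intro divide_right_mono) auto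
    finally show ?thesis using le by simp
  qed
  have "\<bar>?q v1 - ?q v2\<bar> \<le> L / ?k"
    using gap[of v1] gap[of v2] assms by linarith
  then have "(?q v1 - ?q v2)\<^sup>2 \<le> (L / ?k)\<^sup>2"
    using power_mono[of "\<bar>?q v1 - ?q v2\<bar>" "L / ?k" 2] by simp
  also have "\<dots> = L\<^sup>2 / ?k\<^sup>2" by (simp add: power_divide)
  also have "\<dots> \<le> L\<^sup>2 / ((1 + ln (1 / b)) / 8)"
  proof (rule divide_left_mono)
    have "1 + ln (1 / b) \<le> 8 * ?k\<^sup>2"
      using ln_inverse_std_normal_cdf_le[of "?q b"] std_normal_quantile_nonpos[of b] b assms(1)
      by (simp add: std_normal_cdf_quantile)
    then show "(1 + ln (1 / b)) / 8 \<le> ?k\<^sup>2" by simp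
    have "0 \<le> ln (1 / b)" using b by simp
    then show "0 < ?k\<^sup>2 * ((1 + ln (1 / b)) / 8)"
      using reversed_hazard_pos[of "?q b"] by (intro mult_pos_pos zero_less_power) auto
  qed simp
  finally show ?thesis by (simp add: mult.commute)
qed

text \<open>
  A bound for the squared rounding error, up to constants and the factor \<open>1 / p\<close>, in terms of the
  rescaled variable \<open>v = 2\<^sup>p u\<close>. The first branch belongs to the extreme cell, where the error is
  of the order of the square of \<open>ln (1 / v)\<close>. In the \<open>j\<close>-th cell the relative cell width is \<open>1 / j\<close>, and the
  error is of the order of \<open>(1 + ln j) / j\<^sup>2\<close>. Replacing the logarithms by small powers leaves a
  function that is integrable both at \<open>0\<close> and at infinity.
\<close>

definition rounding_weight :: "real \<Rightarrow> real" where
  "rounding_weight v = (if v < 1 then v powr (- 1 / 2) else v powr (- 3 / 2))"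

lemma rounding_weight_nonneg: "0 \<le> rounding_weight v"
  by (simp add: rounding_weight_def)

text \<open>
  This separates the cell number \<open>x\<close> from the number \<open>y\<close> of cells. It is the inequality
  \<open>1 + (a + b) \<le> (1 + a) (1 + b)\<close> for \<open>a = ln x\<close> and \<open>b = ln (y / x)\<close>.
\<close>

lemma inverse_one_plus_ln_quotient_le:
  fixes x y :: real
  assumes "1 \<le> x" "x \<le> y"
  shows "1 / (1 + ln (y / x)) \<le> (1 + ln x) / (1 + ln y)"
proof -
  have "0 \<le> ln x" "0 \<le> ln (y / x)" "0 \<le> ln y" using assms by auto
  moreover have "ln y = ln x + ln (y / x)" using assms by (simp add: ln_div)
  ultimately show ?thesis by (simp add: field_simps)
qed

text \<open>
  Both \<open>u\<close> and the midpoint of its cell are compared with the right end \<open>j / N\<close> of that cell. The cell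
  is closed on both sides so that the statement also serves, after the reflection \<open>u \<mapsto> 1 - u\<close>, for the
  half-open cells in the right half of the unit interval.
\<close>

lemma midpoint_cell_error:
  fixes j N :: nat and u :: real
  assumes j: "1 \<le> j" "2 * j \<le> N"
    and u: "0 < u" "real j - 1 \<le> N * u" "N * u \<le> j"
  shows "(std_normal_quantile u - std_normal_quantile ((real j - 1 / 2) / N))\<^sup>2
    \<le> 128 / (1 + ln N) * rounding_weight (N * u)"
proof -
  define v where "v = N * u"
  have v: "0 < v" "real j - 1 \<le> v" "v \<le> j"
    using u j by (auto simp: v_def)
  have N: "0 < real N" and jr: "1 \<le> real j" using j by simp_all
  have lnN: "0 \<le> ln (real N)" "0 \<le> ln (real j)" using j by auto
  obtain L where L: "ln (j / v) \<le> L" "ln (j / (real j - 1 / 2)) \<le> L"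
    and weight: "L\<^sup>2 * (1 + ln j) \<le> 16 * rounding_weight v"
  proof (cases "v < 1")
    case True
    then have "j = 1" using v(2) j by linarith
    \<comment> \<open>A fourth root of \<open>1 / v\<close>, because its square still has an integrable singularity at \<open>0\<close>.\<close>
    have "ln (v powr (- 1 / 4)) \<le> v powr (- 1 / 4) - 1"
      using v by (intro ln_le_minus_one) simp
    then have "ln (1 / v) \<le> 4 * v powr (- 1 / 4)"
      using v by (simp add: ln_powr ln_div)
    moreover have "1 \<le> v powr (- 1 / 4)"
      using powr_mono2'[of "- 1 / 4" v 1] True v by simp
    moreover have "ln (2::real) \<le> 1" using ln_le_minus_one[of "2::real"] by simp
    moreover have "(4 * v powr (- 1 / 4))\<^sup>2 = 16 * v powr (- 1 / 2)"
      using v by (simp add: power2_eq_square powr_add[symmetric])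
    ultimately show thesis
      using True \<open>j = 1\<close> by (intro that[of "4 * v powr (- 1 / 4)"]) (auto simp: rounding_weight_def)
  next
    case False
    \<comment> \<open>Cells have unit length in the variable \<open>v\<close>, so \<open>j - v \<le> 1\<close>; moreover \<open>v \<le> j \<le> 2 j - 1\<close>.\<close>
    have "ln (j / v) \<le> j / v - 1" using v by (intro ln_le_minus_one) auto
    also have "\<dots> = (j - v) / v" using v by (simp add: diff_divide_distrib)
    also have "\<dots> \<le> 1 / v" using v by (intro divide_right_mono) auto
    finally have 1: "ln (j / v) \<le> 1 / v" .
    have "ln (j / (real j - 1 / 2)) \<le> j / (real j - 1 / 2) - 1"
      using j by (intro ln_le_minus_one) auto
    also have "\<dots> = 1 / (2 * real j - 1)" using j by (simp add: field_simps)
    also have "\<dots> \<le> 1 / v" using jr v by (intro divide_left_mono mult_pos_pos; linarith)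
    finally have 2: "ln (j / (real j - 1 / 2)) \<le> 1 / v" .
    \<comment> \<open>The factor \<open>1 + ln j\<close> is absorbed by half a power of \<open>v\<close>, which leaves the exponent \<open>- 3 / 2\<close>.\<close>
    define s where "s = v powr (1 / 2)"
    have s: "0 < s" using v by (simp add: s_def)
    have "ln j \<le> ln (2 * v)" using j v False by (intro ln_mono) auto
    also have "\<dots> = ln 2 + 2 * ln s" using v by (simp add: s_def ln_mult ln_powr)
    finally have "1 + ln j \<le> 16 * s"
      using ln_le_minus_one[of "2::real"] ln_le_minus_one[OF s] s by linarith
    then have "(1 / v)\<^sup>2 * (1 + ln j) \<le> (v powr (- 1))\<^sup>2 * (16 * s)"
      using v by (intro mult_mono) (auto simp: powr_minus_divide)
    also have "\<dots> = 16 * (v powr (- 1) * v powr (- 1) * v powr (1 / 2))"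
      by (simp add: s_def power2_eq_square)
    also have "\<dots> = 16 * v powr (- 3 / 2)"
      by (simp only: powr_add[symmetric]) simp
    finally show thesis
      using 1 2 False by (intro that[of "1 / v"]) (auto simp: rounding_weight_def)
  qed
  have "(std_normal_quantile u - std_normal_quantile ((real j - 1 / 2) / N))\<^sup>2
      \<le> 8 * L\<^sup>2 / (1 + ln (1 / (j / N)))"
  proof (rule std_normal_quantile_oscillation)
    show "j / N \<le> 1 / 2" using j N by (simp add: field_simps)
    show "0 < u" by (rule u)
    show "u \<le> j / N" using u N by (simp add: pos_le_divide_eq mult.commute)
    have "0 < real j - 1 / 2" using jr by linarith
    then show "0 < (real j - 1 / 2) / N" using N by (rule divide_pos_pos)
    show "(real j - 1 / 2) / N \<le> j / N" by (intro divide_right_mono) auto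
    show "ln (j / N / u) \<le> L" using L(1) by (simp add: v_def)
    show "ln (j / N / ((real j - 1 / 2) / N)) \<le> L" using L(2) N by simp
  qed
  also have "\<dots> = 8 * L\<^sup>2 * (1 / (1 + ln (N / j)))" using N j by simp
  also have "\<dots> \<le> 8 * L\<^sup>2 * ((1 + ln j) / (1 + ln N))"
    using j by (intro mult_left_mono inverse_one_plus_ln_quotient_le) auto
  also have "\<dots> = 8 * (L\<^sup>2 * (1 + ln j)) / (1 + ln N)" by simp
  also have "\<dots> \<le> 8 * (16 * rounding_weight v) / (1 + ln N)"
    using weight lnN by (intro divide_right_mono mult_left_mono) auto
  finally show ?thesis by (simp add: v_def)
qed

definition cell_midpoint :: "nat \<Rightarrow> nat \<Rightarrow> real" where
  "cell_midpoint p k = (real k + 1 / 2) / 2 ^ p"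

lemma cell_midpoint_bounds:
  assumes "k < 2 ^ p"
  shows "0 < cell_midpoint p k" "cell_midpoint p k < 1"
proof -
  have "real k + 1 \<le> real (2 ^ p)" using assms by (metis Suc_leI of_nat_Suc of_nat_le_iff add.commute)
  then show "0 < cell_midpoint p k" "cell_midpoint p k < 1"
    by (auto simp: cell_midpoint_def field_simps)
qed

lemma bit_round_cell:
  assumes "0 < u" "u < 1"
  shows "nat \<lfloor>2 ^ p * u\<rfloor> < 2 ^ p"
    and "bit_round p u = cell_midpoint p (nat \<lfloor>2 ^ p * u\<rfloor>)"
    and "real (nat \<lfloor>2 ^ p * u\<rfloor>) \<le> 2 ^ p * u" "2 ^ p * u < real (nat \<lfloor>2 ^ p * u\<rfloor>) + 1"
proof -
  have "0 \<le> 2 ^ p * u" "2 ^ p * u < 2 ^ p" using assms by auto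
  then have nn: "0 \<le> \<lfloor>2 ^ p * u\<rfloor>" by simp
  then show 1: "real (nat \<lfloor>2 ^ p * u\<rfloor>) \<le> 2 ^ p * u" "2 ^ p * u < real (nat \<lfloor>2 ^ p * u\<rfloor>) + 1"
    by linarith+
  show "bit_round p u = cell_midpoint p (nat \<lfloor>2 ^ p * u\<rfloor>)"
    using nn by (simp add: bit_round_def cell_midpoint_def field_simps)
  have "real (nat \<lfloor>2 ^ p * u\<rfloor>) < 2 ^ p" using 1(1) \<open>2 ^ p * u < 2 ^ p\<close> by (rule le_less_trans)
  then show "nat \<lfloor>2 ^ p * u\<rfloor> < 2 ^ p" by (metis of_nat_less_numeral_power_cancel_iff)
qed

text \<open>
  In the right half of the unit interval, the estimate for the left half is applied to \<open>1 - u\<close>; the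
  midpoints of the cells are symmetric about \<open>1 / 2\<close>.
\<close>

lemma bit_round_error:
  assumes p: "1 \<le> p" and u: "0 < u" "u < 1"
  shows "(std_normal_quantile u - std_normal_quantile (bit_round p u))\<^sup>2
    \<le> 256 / p * (rounding_weight (2 ^ p * u) + rounding_weight (2 ^ p * (1 - u)))"
proof -
  let ?q = std_normal_quantile
  define k where "k = nat \<lfloor>2 ^ p * u\<rfloor>"
  note k = bit_round_cell[OF u, of p, folded k_def]
  \<comment> \<open>The number of cells is even, so \<open>1 / 2\<close> is a cell boundary.\<close>
  obtain m where m: "(2::nat) ^ p = 2 * m"
    using p by (cases p) auto
  have m': "(2::real) ^ p = 2 * real m"
    by (metis m of_nat_mult of_nat_numeral of_nat_power)
  have m0: "0 < real m" using m' by (metis zero_less_power zero_less_mult_pos zero_less_numeral)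
  have "(?q u - ?q (bit_round p u))\<^sup>2
    \<le> 128 / (1 + ln (2 ^ p)) * (rounding_weight (2 ^ p * u) + rounding_weight (2 ^ p * (1 - u)))"
  proof (cases "k < m")
    case True
    have "(?q u - ?q (bit_round p u))\<^sup>2 \<le> 128 / (1 + ln (2 ^ p)) * rounding_weight (2 ^ p * u)"
      using midpoint_cell_error[of "Suc k" "2 * m" u] True k u m'
      by (simp add: cell_midpoint_def algebra_simps)
    also have "\<dots> \<le> 128 / (1 + ln (2 ^ p)) * (rounding_weight (2 ^ p * u) + rounding_weight (2 ^ p * (1 - u)))"
      using rounding_weight_nonneg by (intro mult_left_mono) (auto intro!: divide_nonneg_nonneg add_nonneg_nonneg)
    finally show ?thesis .
  next
    case False
    define j where "j = 2 * m - k"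
    have j: "1 \<le> j" "2 * j \<le> 2 * m" "real j = 2 * real m - real k"
      using False k(1) m by (auto simp: j_def)
    have mid: "(real j - 1 / 2) / real (2 * m) = 1 - bit_round p u"
      using j m0 by (simp add: k(2) cell_midpoint_def m' field_simps)
    have "(?q (1 - u) - ?q (1 - bit_round p u))\<^sup>2
        \<le> 128 / (1 + ln (2 ^ p)) * rounding_weight (2 ^ p * (1 - u))"
      using midpoint_cell_error[OF j(1,2), of "1 - u", unfolded mid] j(3) k u m'
      by (simp add: algebra_simps)
    also have "\<dots> \<le> 128 / (1 + ln (2 ^ p)) * (rounding_weight (2 ^ p * u) + rounding_weight (2 ^ p * (1 - u)))"
      using rounding_weight_nonneg by (intro mult_left_mono) (auto intro!: divide_nonneg_nonneg add_nonneg_nonneg)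
    finally show ?thesis
      using u k(2) cell_midpoint_bounds[OF k(1)]
      by (simp add: std_normal_quantile_minus power2_commute)
  qed
  also have "\<dots> \<le> 256 / p * (rounding_weight (2 ^ p * u) + rounding_weight (2 ^ p * (1 - u)))"
  proof (rule mult_right_mono)
    \<comment> \<open>It suffices that \<open>ln 2 \<ge> 1 / 2\<close>, which is \<open>ln x \<le> x - 1\<close> at \<open>x = 1 / 2\<close>.\<close>
    have "- ln (2::real) \<le> - (1 / 2)"
      using ln_le_minus_one[of "1 / 2 :: real"] by (simp add: ln_div)
    then have "real p * (1 / 2) \<le> real p * ln 2"
      by (intro mult_left_mono) auto
    then have "real p / 2 \<le> 1 + ln (2 ^ p)" by (simp add: ln_realpow)
    then have "128 / (1 + ln (2 ^ p)) \<le> 128 / (real p / 2)"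
      using p by (intro divide_left_mono mult_pos_pos) auto
    then show "128 / (1 + ln (2 ^ p)) \<le> 256 / real p" by simp
  qed (simp add: rounding_weight_nonneg)
  finally show ?thesis .
qed

text \<open>
  The tail bound \<open>\<Phi>(y) \<le> exp (- y\<^sup>2 / 2) / 2\<close>, read at \<open>y = q(u)\<close> and raised to the power \<open>- 1 / 2\<close>. The
  exponent \<open>1 / 4\<close> makes the singularities at \<open>0\<close> and \<open>1\<close> integrable.
\<close>

lemma exp_std_normal_quantile_le:
  assumes "0 < u" "u < 1"
  shows "exp ((std_normal_quantile u)\<^sup>2 / 4) \<le> (2 * u) powr (- 1 / 2) + (2 * (1 - u)) powr (- 1 / 2)"
proof -
  have left: "exp ((std_normal_quantile u)\<^sup>2 / 4) \<le> (2 * u) powr (- 1 / 2)" if u: "0 < u" "u \<le> 1 / 2" for u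
  proof -
    let ?y = "std_normal_quantile u"
    have "u \<le> exp (- ?y\<^sup>2 / 2) / 2"
      using std_normal_cdf_le_exp[OF std_normal_quantile_nonpos[OF u]] u
      by (simp add: std_normal_cdf_quantile)
    then have "exp (- ?y\<^sup>2 / 2) powr (- 1 / 2) \<le> (2 * u) powr (- 1 / 2)"
      using u by (intro powr_mono2') auto
    then show ?thesis by (simp add: powr_def)
  qed
  show ?thesis
  proof (cases "u \<le> 1 / 2")
    case True
    then show ?thesis using left[of u] assms by (simp add: add_increasing2)
  next
    case False
    then have "exp ((std_normal_quantile u)\<^sup>2 / 4) \<le> (2 * (1 - u)) powr (- 1 / 2)"
      using left[of "1 - u"] assms by (simp add: std_normal_quantile_minus)
    then show ?thesis by (simp add: add_increasing)
  qed
qed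

text \<open>
  A cell midpoint is at least half of every point of its cell, and the same holds for the distances
  from \<open>1\<close>.
\<close>

lemma exp_std_normal_quantile_bit_round_le:
  assumes u: "0 < u" "u < 1"
  shows "exp ((std_normal_quantile (bit_round p u))\<^sup>2 / 4) \<le> u powr (- 1 / 2) + (1 - u) powr (- 1 / 2)"
proof -
  define k where "k = nat \<lfloor>2 ^ p * u\<rfloor>"
  note k = bit_round_cell[OF u, of p, folded k_def]
  note t = cell_midpoint_bounds[OF k(1), folded k(2)]
  have "real k + 1 \<le> real (2 ^ p)" using k(1) by (metis Suc_leI of_nat_Suc of_nat_le_iff add.commute)
  then have "u \<le> 2 * bit_round p u" "1 - u \<le> 2 * (1 - bit_round p u)"
    using k(3,4) u unfolding k(2) cell_midpoint_def by (simp_all add: field_simps)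
  then have "(2 * bit_round p u) powr (- 1 / 2) \<le> u powr (- 1 / 2)"
    "(2 * (1 - bit_round p u)) powr (- 1 / 2) \<le> (1 - u) powr (- 1 / 2)"
    using u by (intro powr_mono2'; simp)+
  then show ?thesis using exp_std_normal_quantile_le[OF t] by linarith
qed

section \<open>Integrals over the unit interval\<close>

text \<open>
  Inverse transform sampling. On the open unit interval, the quantile function is the generalized
  inverse that occurs in Skorohod's representation theorem.
\<close>

lemma distr_std_normal_quantile:
  shows measurable_std_normal_quantile:
      "std_normal_quantile \<in> borel_measurable (restrict_space lborel {0<..<1})"
    and "distr (restrict_space lborel {0<..<1}) borel std_normal_quantile = std_normal_distribution"
proof -
  have eq: "Inf {x. u \<le> std_normal_cdf x} = std_normal_quantile u"
    if "u \<in> space (restrict_space lborel {0<..<1})" for u :: real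
  proof -
    have u: "0 < u" "u < 1" using that by (auto simp: space_restrict_space)
    have "u \<le> std_normal_cdf x \<longleftrightarrow> std_normal_quantile u \<le> x" for x
      using std_normal_cdf_le_iff[of "std_normal_quantile u" x] u by (simp only: std_normal_cdf_quantile)
    then have "{x. u \<le> std_normal_cdf x} = {std_normal_quantile u..}" by auto
    then show ?thesis by simp
  qed
  have "(\<lambda>u. Inf {x. u \<le> std_normal_cdf x}) \<in> borel_measurable (restrict_space lborel {0<..<1})"
    using std_normal.measurable_CI by (simp add: measurable_cong_sets[OF sets_restrict_space_cong[OF sets_lborel] refl])
  then show "std_normal_quantile \<in> borel_measurable (restrict_space lborel {0<..<1})"
    by (subst (asm) measurable_cong[OF eq])
  show "distr (restrict_space lborel {0<..<1}) borel std_normal_quantile = std_normal_distribution"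
    by (rule trans[OF distr_cong[OF refl refl eq[symmetric]] std_normal.distr_I_eq_M])
qed

lemma nn_integral_std_normal_distribution:
  assumes [measurable]: "f \<in> borel_measurable borel"
  shows "(\<integral>\<^sup>+x. f x \<partial>std_normal_distribution)
    = (\<integral>\<^sup>+u. f (std_normal_quantile u) * indicator {0<..<1} u \<partial>lborel)"
proof -
  note [measurable] = measurable_std_normal_quantile
  have "(\<integral>\<^sup>+x. f x \<partial>std_normal_distribution)
      = (\<integral>\<^sup>+u. f (std_normal_quantile u) \<partial>restrict_space lborel {0<..<1})"
    by (subst distr_std_normal_quantile(2)[symmetric], subst nn_integral_distr) auto
  then show ?thesis by (simp add: nn_integral_restrict_space)
qed

lemma rounding_weight_measurable [measurable]: "rounding_weight \<in> borel_measurable borel"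
  unfolding rounding_weight_def[abs_def] by measurable

lemma nn_integral_rounding_weight_le:
  "(\<integral>\<^sup>+v. ennreal (rounding_weight v) * indicator {0<..} v \<partial>lborel) \<le> 4"
proof -
  let ?f = "\<lambda>v. ennreal (v powr (- 1 / 2)) * indicator {0..1} v"
  let ?g = "\<lambda>v. ennreal (v powr (- 3 / 2)) * indicator {1..} v"
  have "(\<integral>\<^sup>+v. ennreal (rounding_weight v) * indicator {0<..} v \<partial>lborel) \<le> (\<integral>\<^sup>+v. ?f v + ?g v \<partial>lborel)"
    by (intro nn_integral_mono) (auto simp: rounding_weight_def split: split_indicator)
  also have "\<dots> = (\<integral>\<^sup>+v. ?f v \<partial>lborel) + (\<integral>\<^sup>+v. ?g v \<partial>lborel)"
    by (intro nn_integral_add) auto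
  also have "(\<integral>\<^sup>+v. ?f v \<partial>lborel) = ennreal 2"
    using has_integral_powr_from_0[of "- 1 / 2" 1]
    by (intro nn_integral_has_integral_lebesgue') auto
  also have "(\<integral>\<^sup>+v. ?g v \<partial>lborel) = ennreal 2"
    using has_integral_powr_to_inf[of "- 3 / 2" 1]
    by (intro nn_integral_has_integral_lebesgue') auto
  also have "ennreal 2 + ennreal 2 = 4" by (simp flip: ennreal_plus)
  finally show ?thesis .
qed

text \<open>
  The substitution covers both the distance \<open>v = 2\<^sup>p u\<close> from the left end of the unit interval and the
  distance \<open>v = 2\<^sup>p - 2\<^sup>p u\<close> from its right end.
\<close>

lemma nn_integral_rounding_weight_affine_le:
  assumes c: "c \<noteq> 0" and pos: "\<And>u. 0 < u \<Longrightarrow> u < 1 \<Longrightarrow> 0 < t + c * u"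
  shows "(\<integral>\<^sup>+u. ennreal (rounding_weight (t + c * u)) * indicator {0<..<1} u \<partial>lborel) \<le> ennreal (4 / \<bar>c\<bar>)"
proof -
  let ?W = "\<lambda>v. ennreal (rounding_weight v) * indicator {0<..} v"
  have "\<bar>c\<bar> * (\<integral>\<^sup>+u. ?W (t + c * u) \<partial>lborel) = (\<integral>\<^sup>+v. ?W v \<partial>lborel)"
    by (rule nn_integral_real_affine[OF _ c, symmetric]) measurable
  also have "\<dots> \<le> ennreal 4" using nn_integral_rounding_weight_le by simp
  finally have "ennreal (1 / \<bar>c\<bar>) * (ennreal \<bar>c\<bar> * (\<integral>\<^sup>+u. ?W (t + c * u) \<partial>lborel))
      \<le> ennreal (1 / \<bar>c\<bar>) * ennreal 4"
    by (rule mult_left_mono) simp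
  also have "ennreal (1 / \<bar>c\<bar>) * ennreal 4 = ennreal (4 / \<bar>c\<bar>)"
    by (subst ennreal_mult[symmetric]) auto
  finally have "(\<integral>\<^sup>+u. ?W (t + c * u) \<partial>lborel) \<le> ennreal (4 / \<bar>c\<bar>)"
    using c by (simp add: mult.assoc[symmetric] flip: ennreal_mult)
  moreover have "(\<integral>\<^sup>+u. ennreal (rounding_weight (t + c * u)) * indicator {0<..<1} u \<partial>lborel)
      \<le> (\<integral>\<^sup>+u. ?W (t + c * u) \<partial>lborel)"
    using pos by (intro nn_integral_mono) (auto split: split_indicator)
  ultimately show ?thesis by (rule order_trans[rotated])
qed

definition bit_rounded_value :: "nat \<Rightarrow> real \<Rightarrow> real" where
  "bit_rounded_value p x = std_normal_quantile (bit_round p (std_normal_cdf x))"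

lemma bit_approx_eq: "bit_approx p Y \<omega> = bit_rounded_value p (Y \<omega>)"
  by (simp add: bit_approx_def bit_rounded_value_def)

text \<open>
  The map factors through the integer-valued floor function, so it is measurable whatever values the
  inverse takes outside the open unit interval.
\<close>

lemma bit_rounded_value_measurable [measurable]: "bit_rounded_value p \<in> borel_measurable borel"
proof -
  have [measurable]: "(\<lambda>k::int. std_normal_quantile (real_of_int k / 2 ^ p + 1 / 2 ^ (p + 1)))
      \<in> measurable (count_space UNIV) borel"
    by simp
  have "(\<lambda>x. std_normal_quantile (real_of_int \<lfloor>2 ^ p * std_normal_cdf x\<rfloor> / 2 ^ p + 1 / 2 ^ (p + 1)))
      \<in> borel_measurable borel"
    using std_normal.measurable_C by measurable
  then show ?thesis by (simp add: bit_rounded_value_def[abs_def] bit_round_def)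
qed

lemma nn_integral_rounding_error_le:
  assumes "1 \<le> p"
  shows "(\<integral>\<^sup>+x. ennreal ((x - bit_rounded_value p x)\<^sup>2) \<partial>std_normal_distribution)
    \<le> ennreal (2048 / (2 ^ p * real p))"
proof -
  let ?w = "rounding_weight"
  have "(\<integral>\<^sup>+x. ennreal ((x - bit_rounded_value p x)\<^sup>2) \<partial>std_normal_distribution)
      = (\<integral>\<^sup>+u. ennreal ((std_normal_quantile u - bit_rounded_value p (std_normal_quantile u))\<^sup>2)
          * indicator {0<..<1} u \<partial>lborel)"
    by (rule nn_integral_std_normal_distribution) measurable
  also have "\<dots> \<le> (\<integral>\<^sup>+u. ennreal (256 / p) * (ennreal (?w (0 + 2 ^ p * u)) * indicator {0<..<1} u
        + ennreal (?w (2 ^ p + (- (2 ^ p)) * u)) * indicator {0<..<1} u) \<partial>lborel)"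
  proof (rule nn_integral_mono)
    fix u :: real
    show "ennreal ((std_normal_quantile u - bit_rounded_value p (std_normal_quantile u))\<^sup>2)
          * indicator {0<..<1} u
      \<le> ennreal (256 / p) * (ennreal (?w (0 + 2 ^ p * u)) * indicator {0<..<1} u
        + ennreal (?w (2 ^ p + (- (2 ^ p)) * u)) * indicator {0<..<1} u)"
    proof (cases "u \<in> {0<..<1}")
      case True
      then have "(std_normal_quantile u - bit_rounded_value p (std_normal_quantile u))\<^sup>2
        \<le> 256 / p * (?w (0 + 2 ^ p * u) + ?w (2 ^ p + (- (2 ^ p)) * u))"
        using bit_round_error[OF assms, of u]
        by (simp add: bit_rounded_value_def std_normal_cdf_quantile algebra_simps)
      then show ?thesis
        using True by (simp add: rounding_weight_nonneg flip: ennreal_mult ennreal_plus)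
    qed simp
  qed
  also have "\<dots> = ennreal (256 / p) * ((\<integral>\<^sup>+u. ennreal (?w (0 + 2 ^ p * u)) * indicator {0<..<1} u \<partial>lborel)
        + (\<integral>\<^sup>+u. ennreal (?w (2 ^ p + (- (2 ^ p)) * u)) * indicator {0<..<1} u \<partial>lborel))"
    by (subst nn_integral_cmult, measurable, subst nn_integral_add, measurable)
  also have "\<dots> \<le> ennreal (256 / p) * (ennreal (4 / \<bar>2 ^ p\<bar>) + ennreal (4 / \<bar>- (2 ^ p)\<bar>))"
    by (intro mult_left_mono add_mono nn_integral_rounding_weight_affine_le) auto
  also have "\<dots> = ennreal (2048 / (2 ^ p * real p))"
    by (simp flip: ennreal_mult ennreal_plus)
  finally show ?thesis .
qed

text \<open>
  Combines \<open>ln x \<le> x\<close> with \<open>r x \<le> r\<^sup>2 + x\<^sup>2 / 4\<close>, so that a single exponential moment controls all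
  absolute moments.
\<close>

lemma powr_le_exp_square:
  fixes x r :: real
  assumes "0 \<le> x" "0 \<le> r"
  shows "x powr r \<le> exp (r\<^sup>2) * exp (x\<^sup>2 / 4)"
proof (cases "x = 0")
  case False
  have "r * ln x \<le> r * x"
    using assms False ln_le_minus_one[of x] by (intro mult_left_mono) auto
  also have "\<dots> \<le> r\<^sup>2 + x\<^sup>2 / 4"
    using zero_le_power2[of "r - x / 2"] by (simp add: power2_eq_square algebra_simps)
  finally show ?thesis using False by (simp add: powr_def mult_exp_exp)
qed simp

lemma nn_integral_bit_rounded_value_powr_le:
  assumes "0 \<le> r"
  shows "(\<integral>\<^sup>+x. ennreal (\<bar>bit_rounded_value p x\<bar> powr r) \<partial>std_normal_distribution)
    \<le> ennreal (4 * exp (r\<^sup>2))"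
proof -
  let ?h = "\<lambda>v. ennreal (v powr (- 1 / 2)) * indicator {0..1} v"
  have h: "(\<integral>\<^sup>+v. ?h v \<partial>lborel) = ennreal 2"
    using has_integral_powr_from_0[of "- 1 / 2" 1]
    by (intro nn_integral_has_integral_lebesgue') auto
  have h': "(\<integral>\<^sup>+v. ?h (1 + (- 1) * v) \<partial>lborel) = ennreal 2"
    using nn_integral_real_affine[of ?h "-1" 1] h by simp
  have sum: "ennreal 2 + ennreal 2 = ennreal 4"
    by (subst ennreal_plus[symmetric]) auto
  have "(\<integral>\<^sup>+x. ennreal (\<bar>bit_rounded_value p x\<bar> powr r) \<partial>std_normal_distribution)
      = (\<integral>\<^sup>+u. ennreal (\<bar>bit_rounded_value p (std_normal_quantile u)\<bar> powr r)
          * indicator {0<..<1} u \<partial>lborel)"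
    by (rule nn_integral_std_normal_distribution) measurable
  also have "\<dots> \<le> (\<integral>\<^sup>+u. ennreal (exp (r\<^sup>2)) * (?h u + ?h (1 + (- 1) * u)) \<partial>lborel)"
  proof (rule nn_integral_mono)
    fix u :: real
    show "ennreal (\<bar>bit_rounded_value p (std_normal_quantile u)\<bar> powr r) * indicator {0<..<1} u
      \<le> ennreal (exp (r\<^sup>2)) * (?h u + ?h (1 + (- 1) * u))"
    proof (cases "u \<in> {0<..<1}")
      case True
      then have u: "0 < u" "u < 1" by auto
      have "\<bar>bit_rounded_value p (std_normal_quantile u)\<bar> powr r
          \<le> exp (r\<^sup>2) * exp ((std_normal_quantile (bit_round p u))\<^sup>2 / 4)"
        using powr_le_exp_square[of "\<bar>std_normal_quantile (bit_round p u)\<bar>" r] assms u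
        by (simp add: bit_rounded_value_def std_normal_cdf_quantile)
      also have "\<dots> \<le> exp (r\<^sup>2) * (u powr (- 1 / 2) + (1 - u) powr (- 1 / 2))"
        by (intro mult_left_mono exp_std_normal_quantile_bit_round_le u) simp
      finally show ?thesis
        using True by (simp flip: ennreal_mult ennreal_plus)
    qed simp
  qed
  also have "\<dots> = ennreal (exp (r\<^sup>2)) * ((\<integral>\<^sup>+u. ?h u \<partial>lborel) + (\<integral>\<^sup>+u. ?h (1 + (- 1) * u) \<partial>lborel))"
    by (subst nn_integral_cmult, measurable, subst nn_integral_add, measurable)
  also have "\<dots> = ennreal (4 * exp (r\<^sup>2))"
    unfolding h h' sum by (subst ennreal_mult[symmetric]) (auto simp: mult.commute)
  finally show ?thesis .
qed

section \<open>The rounded variable is a function of random bits\<close>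

lemma distr_uniform_count_measure_bij:
  assumes "finite A" "bij_betw b A B"
  shows "distr (uniform_count_measure A) (count_space B) b = uniform_count_measure B"
proof -
  have [measurable]: "b \<in> measurable (uniform_count_measure A) (count_space B)"
    using assms(2) by (auto simp: measurable_def bij_betw_def space_uniform_count_measure sets_uniform_count_measure)
  have fin: "finite B" using assms bij_betw_finite by blast
  show ?thesis
  proof (rule measure_eqI)
    fix X assume "X \<in> sets (distr (uniform_count_measure A) (count_space B) b)"
    then have X: "X \<subseteq> B" by simp
    have "bij_betw b (b -` X \<inter> A) X"
      using assms(2) X by (auto simp: bij_betw_def inj_on_def)
    then have "card (b -` X \<inter> A) = card X" by (rule bij_betw_same_card)
    moreover have "card A = card B" using assms(2) by (rule bij_betw_same_card)
    ultimately show "emeasure (distr (uniform_count_measure A) (count_space B) b) X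
        = emeasure (uniform_count_measure B) X"
      using X fin assms(1)
      by (simp add: emeasure_distr emeasure_uniform_count_measure space_uniform_count_measure)
  qed (simp add: sets_uniform_count_measure)
qed

lemma cell_index_measurable:
  "(\<lambda>u::real. nat \<lfloor>2 ^ p * u\<rfloor>) \<in> measurable (restrict_space lborel {0<..<1}) (count_space {..<2 ^ p})"
proof -
  let ?R = "restrict_space lborel {0<..<1::real}" and ?K = "\<lambda>u::real. nat \<lfloor>2 ^ p * u\<rfloor>"
  have K: "?K \<in> measurable ?R (count_space UNIV)"
    by (intro measurable_restrict_space1) measurable
  show ?thesis
    unfolding measurable_count_space_eq2[OF finite_lessThan]
  proof (intro conjI ballI)
    show "?K \<in> space ?R \<rightarrow> {..<2 ^ p}"
      using bit_round_cell(1) by (auto simp: space_restrict_space)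
    show "?K -` {k} \<inter> space ?R \<in> sets ?R" for k
      by (rule measurable_sets[OF K]) auto
  qed
qed

text \<open>
  All \<open>2\<^sup>p\<close> cells have length \<open>1 / 2\<^sup>p\<close>. The first one is singled out because it loses its left end
  point in the open unit interval.
\<close>

lemma distr_cell_index:
  "distr (restrict_space lborel {0<..<1}) (count_space {..<2 ^ p}) (\<lambda>u::real. nat \<lfloor>2 ^ p * u\<rfloor>)
    = uniform_count_measure {..<2 ^ p}"
proof -
  let ?R = "restrict_space lborel {0<..<1::real}" and ?K = "\<lambda>u::real. nat \<lfloor>2 ^ p * u\<rfloor>"
  have pre: "?K -` {k} \<inter> space ?R = (if k = 0 then {0<..<1 / 2 ^ p} else {k / 2 ^ p..<(k + 1) / 2 ^ p})"
    if "k < 2 ^ p" for k :: nat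
  proof (rule set_eqI)
    fix u :: real
    have k: "real k + 1 \<le> 2 ^ p" using that
      by (metis Suc_leI of_nat_Suc of_nat_le_iff add.commute of_nat_power of_nat_numeral)
    have conv: "k / 2 ^ p \<le> u \<longleftrightarrow> real k \<le> 2 ^ p * u" "u < (k + 1) / 2 ^ p \<longleftrightarrow> 2 ^ p * u < real k + 1"
      by (simp_all add: pos_divide_le_eq pos_less_divide_eq mult.commute add.commute)
    have "?K u = k \<longleftrightarrow> real k \<le> 2 ^ p * u \<and> 2 ^ p * u < real k + 1" if "0 < u"
    proof -
      have "0 \<le> 2 ^ p * u" using that by simp
      then show ?thesis by linarith
    qed
    moreover have "u < 1" if "2 ^ p * u < real k + 1"
      using less_le_trans[OF that k] by simp
    moreover have "0 < u" if "real k \<le> 2 ^ p * u" "k \<noteq> 0"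
    proof -
      have "0 < 2 ^ p * u" using that by linarith
      then show ?thesis by (simp add: zero_less_mult_iff)
    qed
    ultimately show "u \<in> ?K -` {k} \<inter> space ?R
        \<longleftrightarrow> u \<in> (if k = 0 then {0<..<1 / 2 ^ p} else {k / 2 ^ p..<(k + 1) / 2 ^ p})"
      using conv by (auto simp: space_restrict_space add.commute)
  qed
  show ?thesis
  proof (rule measure_eqI_finite[where A = "{..<2 ^ p}"])
    fix k :: nat assume "k \<in> {..<2 ^ p}"
    then have k: "k < 2 ^ p" by simp
    have "emeasure (distr ?R (count_space {..<2 ^ p}) ?K) {k} = emeasure ?R (?K -` {k} \<inter> space ?R)"
      using k by (intro emeasure_distr cell_index_measurable) auto
    also have "\<dots> = emeasure lborel (?K -` {k} \<inter> space ?R)"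
      by (intro emeasure_restrict_space) (auto simp: space_restrict_space)
    also have "\<dots> = ennreal (1 / 2 ^ p)"
      unfolding pre[OF k] by (auto simp: diff_divide_distrib[symmetric] divide_right_mono)
    also have "\<dots> = emeasure (uniform_count_measure {..<2 ^ p}) {k}"
      using k by (simp add: emeasure_uniform_count_measure)
    finally show "emeasure (distr ?R (count_space {..<2 ^ p}) ?K) {k}
        = emeasure (uniform_count_measure {..<2 ^ p}) {k}" .
  qed (auto simp: sets_uniform_count_measure)
qed

lemma bit_rounded_value_distr:
  "distr std_normal_distribution borel (bit_rounded_value p)
    = distr (uniform_count_measure {..<2 ^ p}) borel (\<lambda>k. std_normal_quantile (cell_midpoint p k))"
proof -
  let ?R = "restrict_space lborel {0<..<1::real}" and ?K = "\<lambda>u::real. nat \<lfloor>2 ^ p * u\<rfloor>"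
  let ?f = "\<lambda>k. std_normal_quantile (cell_midpoint p k)"
  note [measurable] = measurable_std_normal_quantile
  have [measurable]: "?K \<in> measurable ?R (count_space {..<2 ^ p})"
    by (rule cell_index_measurable)
  have "distr std_normal_distribution borel (bit_rounded_value p)
      = distr (distr ?R borel std_normal_quantile) borel (bit_rounded_value p)"
    by (simp only: distr_std_normal_quantile(2))
  also have "\<dots> = distr ?R borel (bit_rounded_value p \<circ> std_normal_quantile)"
    by (intro distr_distr) measurable
  also have "\<dots> = distr ?R borel (?f \<circ> ?K)"
    by (intro distr_cong)
       (auto simp: space_restrict_space bit_rounded_value_def std_normal_cdf_quantile bit_round_cell(2))
  also have "\<dots> = distr (distr ?R (count_space {..<2 ^ p}) ?K) borel ?f"
    by (intro distr_distr[symmetric]) measurable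
  finally show ?thesis by (simp only: distr_cell_index)
qed

lemma bit_rounded_value_distr_random_bits:
  "distr std_normal_distribution borel (bit_rounded_value p) \<in> random_bit_measures p"
proof -
  let ?A = "{1..p} \<rightarrow>\<^sub>E {0, 1::nat}"
  let ?f = "\<lambda>k. std_normal_quantile (cell_midpoint p k)"
  have fin: "finite ?A" by (intro finite_PiE) auto
  have "card ?A = 2 ^ p" by (simp add: card_PiE numeral_2_eq_2)
  then obtain b where b: "bij_betw b ?A {..<2 ^ p :: nat}"
    using finite_same_card_bij[OF fin, of "{..<2 ^ p :: nat}"] by auto
  have [measurable]: "b \<in> measurable (uniform_count_measure ?A) (count_space {..<2 ^ p})"
    using b by (auto simp: measurable_def bij_betw_def space_uniform_count_measure sets_uniform_count_measure)
  have "distr std_normal_distribution borel (bit_rounded_value p)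
      = distr (distr (uniform_count_measure ?A) (count_space {..<2 ^ p}) b) borel ?f"
    by (simp only: bit_rounded_value_distr distr_uniform_count_measure_bij[OF fin b])
  also have "\<dots> = distr (uniform_count_measure ?A) borel (?f \<circ> b)"
    by (intro distr_distr) measurable
  finally show ?thesis unfolding random_bit_measures_def by blast
qed

text \<open>
  The law is uniform on the values of the quantile function at the cell midpoints, and the reflection
  \<open>k \<mapsto> 2\<^sup>p - 1 - k\<close> changes the sign of these values.
\<close>

lemma expectation_bit_rounded_value:
  "integrable std_normal_distribution (bit_rounded_value p)"
  "(\<integral>x. bit_rounded_value p x \<partial>std_normal_distribution) = 0"
proof -
  let ?U = "uniform_count_measure {..<2 ^ p :: nat}"
  let ?f = "\<lambda>k. std_normal_quantile (cell_midpoint p k)"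
  have [measurable]: "?f \<in> borel_measurable ?U"
    by (simp add: measurable_cong_sets[OF sets_uniform_count_measure_count_space refl])
  have "integrable ?U ?f"
    unfolding uniform_count_measure_def by (simp add: integrable_point_measure_finite)
  then have "integrable (distr ?U borel ?f) (\<lambda>x. x)"
    by (simp add: integrable_distr_eq)
  then show "integrable std_normal_distribution (bit_rounded_value p)"
    unfolding bit_rounded_value_distr[symmetric] by (simp add: integrable_distr_eq)
  have "(\<Sum>k<2 ^ p. ?f k) = (\<Sum>k<2 ^ p. ?f (2 ^ p - Suc k))"
    by (rule sum.nat_diff_reindex[symmetric])
  also have "\<dots> = (\<Sum>k<2 ^ p. - ?f k)"
  proof (rule sum.cong[OF refl])
    fix k :: nat assume "k \<in> {..<2 ^ p}"
    then have k: "k < 2 ^ p" by simp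
    then have "real (2 ^ p - Suc k) = 2 ^ p - (real k + 1)" by (simp add: of_nat_diff)
    then have "cell_midpoint p (2 ^ p - Suc k) = 1 - cell_midpoint p k"
      by (simp add: cell_midpoint_def field_simps)
    then show "?f (2 ^ p - Suc k) = - ?f k"
      using cell_midpoint_bounds[OF k] by (simp add: std_normal_quantile_minus)
  qed
  finally have "(\<Sum>k<2 ^ p. ?f k) = 0" by (simp add: sum_negf)
  moreover have "(\<integral>x. bit_rounded_value p x \<partial>std_normal_distribution)
      = (\<integral>x. x \<partial>distr std_normal_distribution borel (bit_rounded_value p))"
    by (subst integral_distr) auto
  moreover have "\<dots> = (\<integral>k. ?f k \<partial>?U)"
    unfolding bit_rounded_value_distr by (subst integral_distr) auto
  ultimately show "(\<integral>x. bit_rounded_value p x \<partial>std_normal_distribution) = 0"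
    by (simp add: integral_uniform_count_measure)
qed

section \<open>Bounds for the random bit approximation error\<close>

lemma std_normal_second_moment_measures: "std_normal_distribution \<in> second_moment_measures"
  using std_normal.prob_space_axioms integrable_std_normal_distribution_moment[of 2]
  by (simp add: second_moment_measures_def)

lemma coupling_costs_nonneg: "c \<in> coupling_costs T \<mu>1 \<mu>2 \<Longrightarrow> 0 \<le> c"
  by (auto simp: coupling_costs_def intro!: Bochner_Integration.integral_nonneg)

lemma wasserstein2_le_coupling:
  fixes X1 X2 :: "'w \<Rightarrow> 'v::{banach, second_countable_topology}"
  assumes "prob_space M" "X1 \<in> borel_measurable M" "X2 \<in> borel_measurable M"
    and "distr M borel X1 = \<mu>1" "distr M borel X2 = \<mu>2"
  shows "wasserstein2 \<mu>1 \<mu>2 \<le> sqrt (prob_space.expectation M (\<lambda>\<omega>. (norm (X1 \<omega> - X2 \<omega>))\<^sup>2))"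
proof -
  have "sqrt (prob_space.expectation M (\<lambda>\<omega>. (norm (X1 \<omega> - X2 \<omega>))\<^sup>2)) \<in> coupling_costs TYPE('w) \<mu>1 \<mu>2"
    using assms unfolding coupling_costs_def by blast
  then show ?thesis
    unfolding wasserstein2_def using coupling_costs_subset coupling_costs_nonneg
    by (intro cInf_lower) (auto intro!: bdd_belowI[of _ 0])
qed

lemma wasserstein2_ge:
  fixes \<mu>1 \<mu>2 :: "'v::{banach, second_countable_topology} measure"
  assumes "\<mu>1 \<in> second_moment_measures" "\<mu>2 \<in> second_moment_measures"
    and "\<And>c. c \<in> coupling_costs TYPE('v \<times> 'v) \<mu>1 \<mu>2 \<Longrightarrow> e \<le> c"
  shows "e \<le> wasserstein2 \<mu>1 \<mu>2"
  unfolding wasserstein2_def using coupling_costs_nonempty[OF assms(1,2)] assms(3)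
  by (rule cInf_greatest)

lemma rbit_le_wasserstein2:
  assumes "\<mu> \<in> second_moment_measures" "\<nu> \<in> random_bit_measures p"
  shows "rbit \<mu> p \<le> wasserstein2 \<mu> \<nu>"
  unfolding rbit_def
proof (rule cInf_lower)
  show "wasserstein2 \<mu> \<nu> \<in> {wasserstein2 \<mu> \<nu> |\<nu>. \<nu> \<in> random_bit_measures p}"
    using assms(2) by blast
  have "0 \<le> wasserstein2 \<mu> \<nu>" if "\<nu> \<in> random_bit_measures p" for \<nu>
    using that assms(1) random_bit_measures_subset
    by (intro wasserstein2_ge coupling_costs_nonneg) auto
  then show "bdd_below {wasserstein2 \<mu> \<nu> |\<nu>. \<nu> \<in> random_bit_measures p}"
    by (auto intro!: bdd_belowI[of _ 0])
qed

lemma rbit_ge: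
  assumes "\<And>\<nu>. \<nu> \<in> random_bit_measures p \<Longrightarrow> e \<le> wasserstein2 \<mu> \<nu>"
  shows "e \<le> rbit \<mu> p"
  unfolding rbit_def using assms by (intro cInf_greatest) (auto simp: random_bit_measures_def)

lemma random_bit_measure_quantized:
  assumes "\<nu> \<in> random_bit_measures p" "A \<in> sets borel"
  shows "measure \<nu> A = 0 \<or> 1 / 2 ^ p \<le> measure \<nu> A"
proof -
  define B where "B = {1..p} \<rightarrow>\<^sub>E {0, 1::nat}"
  obtain f where \<nu>: "\<nu> = distr (uniform_count_measure B) borel f"
    using assms(1) by (auto simp: random_bit_measures_def B_def)
  have fin: "finite B" unfolding B_def by (intro finite_PiE) auto
  have card: "card B = 2 ^ p" by (simp add: B_def card_PiE numeral_2_eq_2)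
  have "f \<in> borel_measurable (uniform_count_measure B)"
    by (simp add: measurable_cong_sets[OF sets_uniform_count_measure_count_space refl])
  then have "measure \<nu> A = real (card (f -` A \<inter> B)) / 2 ^ p"
    unfolding \<nu> using assms(2) fin
    by (simp add: measure_distr space_uniform_count_measure measure_uniform_count_measure card)
  then show ?thesis
    by (cases "card (f -` A \<inter> B)") (auto simp: divide_right_mono)
qed

text \<open>
  Let \<open>m\<close> be the midpoint of \<open>s\<close> and \<open>t\<close>. If \<open>X2\<close> has no mass below \<open>m\<close>, then the mass \<open>\<delta> / 4\<close> of \<open>X1\<close> below
  \<open>s\<close> has to be moved to the right of \<open>m\<close>. Otherwise \<open>X2\<close> has mass at least \<open>\<delta>\<close> below \<open>m\<close>, of which at
  most \<open>3 \<delta> / 4\<close> can come from the part of \<open>X1\<close> up to \<open>t\<close>, so a mass \<open>\<delta> / 4\<close> comes from beyond \<open>t\<close>. In both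
  cases the distance is at least \<open>(t - s) / 2\<close>.
\<close>

lemma quantized_coupling_lower_bound:
  fixes X1 X2 :: "'w \<Rightarrow> real"
  assumes M: "prob_space M"
    and [measurable]: "X1 \<in> borel_measurable M" "X2 \<in> borel_measurable M"
    and int: "integrable M (\<lambda>\<omega>. (X1 \<omega> - X2 \<omega>)\<^sup>2)"
    and st: "s \<le> t"
    and s: "\<delta> / 4 \<le> measure M {\<omega>\<in>space M. X1 \<omega> \<le> s}"
    and t: "measure M {\<omega>\<in>space M. X1 \<omega> \<le> t} \<le> 3 / 4 * \<delta>"
    and quantized: "measure M {\<omega>\<in>space M. X2 \<omega> < (s + t) / 2} = 0
      \<or> \<delta> \<le> measure M {\<omega>\<in>space M. X2 \<omega> < (s + t) / 2}"
  shows "(t - s)\<^sup>2 * \<delta> / 16 \<le> prob_space.expectation M (\<lambda>\<omega>. (X1 \<omega> - X2 \<omega>)\<^sup>2)"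
proof -
  interpret prob_space M by fact
  have sq: "((t - s) / 2)\<^sup>2 * prob A \<le> expectation (\<lambda>\<omega>. (X1 \<omega> - X2 \<omega>)\<^sup>2)"
    if [measurable]: "A \<in> sets M" and far: "\<And>\<omega>. \<omega> \<in> A \<Longrightarrow> (t - s) / 2 \<le> \<bar>X1 \<omega> - X2 \<omega>\<bar>" for A
  proof -
    have "((t - s) / 2)\<^sup>2 * prob A = expectation (\<lambda>\<omega>. ((t - s) / 2)\<^sup>2 * indicator A \<omega>)"
      by simp
    also have "\<dots> \<le> expectation (\<lambda>\<omega>. (X1 \<omega> - X2 \<omega>)\<^sup>2)"
    proof (rule integral_mono)
      show "integrable M (\<lambda>\<omega>. ((t - s) / 2)\<^sup>2 * indicator A \<omega>)"
        by (auto simp: integrable_indicator_iff emeasure_eq_measure)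
      show "((t - s) / 2)\<^sup>2 * indicator A \<omega> \<le> (X1 \<omega> - X2 \<omega>)\<^sup>2" for \<omega>
      proof (cases "\<omega> \<in> A")
        case True
        have "((t - s) / 2)\<^sup>2 \<le> \<bar>X1 \<omega> - X2 \<omega>\<bar>\<^sup>2"
          using far[OF True] st by (intro power_mono) auto
        then show ?thesis using True by simp
      qed simp
    qed (rule int)
    finally show ?thesis .
  qed
  have "\<exists>A\<in>sets M. \<delta> / 4 \<le> prob A \<and> (\<forall>\<omega>\<in>A. (t - s) / 2 \<le> \<bar>X1 \<omega> - X2 \<omega>\<bar>)"
    using quantized
  proof (elim disjE)
    assume 0: "prob {\<omega>\<in>space M. X2 \<omega> < (s + t) / 2} = 0"
    let ?A = "{\<omega>\<in>space M. X1 \<omega> \<le> s \<and> \<not> X2 \<omega> < (s + t) / 2}"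
    have "prob {\<omega>\<in>space M. X1 \<omega> \<le> s} \<le> prob (?A \<union> {\<omega>\<in>space M. X2 \<omega> < (s + t) / 2})"
      by (intro finite_measure_mono) auto
    also have "\<dots> \<le> prob ?A + prob {\<omega>\<in>space M. X2 \<omega> < (s + t) / 2}"
      by (intro measure_Un_le) auto
    finally have "\<delta> / 4 \<le> prob ?A" using s 0 by linarith
    moreover have "(t - s) / 2 \<le> \<bar>a - b\<bar>" if "a \<le> s" "\<not> b < (s + t) / 2" for a b
      using that by (auto simp: abs_if field_simps)
    ultimately show ?thesis by (intro bexI[of _ ?A]) auto
  next
    assume 1: "\<delta> \<le> prob {\<omega>\<in>space M. X2 \<omega> < (s + t) / 2}"
    let ?A = "{\<omega>\<in>space M. \<not> X1 \<omega> \<le> t \<and> X2 \<omega> < (s + t) / 2}"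
    have "prob {\<omega>\<in>space M. X2 \<omega> < (s + t) / 2} \<le> prob (?A \<union> {\<omega>\<in>space M. X1 \<omega> \<le> t})"
      by (intro finite_measure_mono) auto
    also have "\<dots> \<le> prob ?A + prob {\<omega>\<in>space M. X1 \<omega> \<le> t}"
      by (intro measure_Un_le) auto
    finally have "\<delta> / 4 \<le> prob ?A" using t 1 by linarith
    moreover have "(t - s) / 2 \<le> \<bar>a - b\<bar>" if "\<not> a \<le> t" "b < (s + t) / 2" for a b
      using that by (auto simp: abs_if field_simps)
    ultimately show ?thesis by (intro bexI[of _ ?A]) auto
  qed
  then obtain A where A: "A \<in> sets M" "\<delta> / 4 \<le> prob A" "\<forall>\<omega>\<in>A. (t - s) / 2 \<le> \<bar>X1 \<omega> - X2 \<omega>\<bar>"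
    by blast
  have "(t - s)\<^sup>2 * \<delta> / 16 = ((t - s) / 2)\<^sup>2 * (\<delta> / 4)"
    by (simp add: power_divide)
  also have "\<dots> \<le> ((t - s) / 2)\<^sup>2 * prob A"
    using A by (intro mult_left_mono) auto
  also have "\<dots> \<le> expectation (\<lambda>\<omega>. (X1 \<omega> - X2 \<omega>)\<^sup>2)"
    using A by (intro sq) auto
  finally show ?thesis .
qed

text \<open>
  With \<open>s\<close> and \<open>t\<close> denoting the two quantiles, the mass \<open>1 / (2 N)\<close> between them is at most
  \<open>(t - s) \<phi>(t)\<close>, and \<open>\<phi>(t) = 3 k(t) / (4 N)\<close>. So \<open>t - s\<close> is at least \<open>2 / (3 k(t))\<close>, where \<open>k(t)\<close> is of the
  order of \<open>1 + \<bar>t\<bar>\<close>, and \<open>t\<^sup>2\<close> is at most of the order of \<open>p\<close> by the Gaussian tail bound.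
\<close>

lemma std_normal_quantile_tail_gap:
  assumes "1 \<le> p"
  shows "1 / (50 * sqrt p) \<le> std_normal_quantile (3 / 4 / 2 ^ p) - std_normal_quantile (1 / 4 / 2 ^ p)"
proof -
  have N: "(2::real) \<le> 2 ^ p" using self_le_power[of "2::real" p] assms by simp
  define s t where "s = std_normal_quantile (1 / 4 / 2 ^ p)" and "t = std_normal_quantile (3 / 4 / 2 ^ p)"
  have in01: "0 < 3 / 4 / (2::real) ^ p" "3 / 4 / (2::real) ^ p \<le> 1 / 2" "1 / 4 / (2::real) ^ p < 1"
    using N by (auto simp: divide_simps)
  have st: "std_normal_cdf s = 1 / 4 / 2 ^ p" "std_normal_cdf t = 3 / 4 / 2 ^ p"
    using in01 by (auto simp: s_def t_def intro!: std_normal_cdf_quantile)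
  have "t \<le> 0" unfolding t_def using in01 by (intro std_normal_quantile_nonpos) auto
  have "s < t" using std_normal_cdf_less_iff[of s t] unfolding st by (simp add: divide_strict_right_mono)
  have "1 / 2 / 2 ^ p \<le> (t - s) * std_normal_density t"
  proof -
    obtain z where z: "s < z" "z < t" "std_normal_cdf t - std_normal_cdf s = (t - s) * std_normal_density z"
      using MVT2[OF \<open>s < t\<close> std_normal_cdf_has_derivative] by blast
    have "t\<^sup>2 \<le> z\<^sup>2" using z \<open>t \<le> 0\<close> by (simp add: abs_le_square_iff[symmetric])
    then have "std_normal_density z \<le> std_normal_density t"
      by (simp add: std_normal_density_def[of z] std_normal_density_def[of t] divide_right_mono)
    then have "(t - s) * std_normal_density z \<le> (t - s) * std_normal_density t"
      using \<open>s < t\<close> by (intro mult_left_mono) auto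
    moreover have "1 / 2 / 2 ^ p = (t - s) * std_normal_density z"
      using z(3) unfolding st by (simp add: diff_divide_distrib[symmetric])
    ultimately show ?thesis by linarith
  qed
  also have "std_normal_density t = reversed_hazard t * (3 / 4 / 2 ^ p)"
    using std_normal_cdf_eq[of t] reversed_hazard_pos[of t] unfolding st by (simp add: field_simps)
  finally have "2 / 3 \<le> (t - s) * reversed_hazard t"
    by (simp add: field_simps)
  \<comment> \<open>The two factors bound \<open>exp (3 / 2)\<close> and \<open>1 - t\<close>, respectively.\<close>
  also have "\<dots> \<le> (t - s) * (9 * (3 * sqrt p))"
  proof (rule mult_left_mono)
    have "1 / 2 ^ p \<le> exp (- t\<^sup>2 / 2)"
      using std_normal_cdf_le_exp[OF \<open>t \<le> 0\<close>] unfolding st by (simp add: field_simps)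
    then have "ln (1 / 2 ^ p) \<le> ln (exp (- t\<^sup>2 / 2))" by (intro ln_mono) auto
    then have "t\<^sup>2 \<le> 2 * (real p * ln 2)" by (simp add: ln_div ln_realpow)
    also have "\<dots> \<le> 4 * (real p * 1)"
      using ln_le_minus_one[of "2::real"] by (intro mult_mono) auto
    also have "\<dots> = (2 * sqrt p)\<^sup>2" by (simp add: power_mult_distrib)
    finally have "(- t)\<^sup>2 \<le> (2 * sqrt p)\<^sup>2" by simp
    then have "- t \<le> 2 * sqrt p" by (rule power2_le_imp_le) simp
    moreover have "1 \<le> sqrt p" using assms by simp
    ultimately have "1 - t \<le> 3 * sqrt p" by linarith
    moreover have "exp (3 / 2) \<le> (9::real)"
    proof -
      have "exp (3 / 2) \<le> exp (1 + 1 :: real)" by (subst exp_le_cancel_iff) simp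
      also have "\<dots> \<le> 3 * 3" unfolding exp_add using exp_le by (intro mult_mono) auto
      finally show ?thesis by simp
    qed
    ultimately have "exp (3 / 2) * (1 - t) \<le> 9 * (3 * sqrt p)"
      using \<open>t \<le> 0\<close> by (intro mult_mono) auto
    then show "reversed_hazard t \<le> 9 * (3 * sqrt p)"
      using reversed_hazard_upper[OF \<open>t \<le> 0\<close>] by linarith
  qed (use \<open>s < t\<close> in simp)
  finally show ?thesis
    using assms by (simp add: s_def t_def field_simps)
qed

lemma rate_square:
  assumes "1 \<le> p"
  shows "(2 powr (- real p / 2) * real p powr (- 1 / 2))\<^sup>2 = 1 / 2 ^ p * (1 / real p)"
proof -
  have sq: "(x powr a)\<^sup>2 = x powr (a + a)" for x a :: real
    by (simp only: power2_eq_square powr_add)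
  have "2 powr (- real p) = 1 / 2 ^ p" "real p powr (- 1) = 1 / real p"
    using assms by (simp_all add: powr_minus_divide powr_realpow)
  then show ?thesis unfolding power_mult_distrib sq by simp
qed

lemma rbit_std_normal_ge:
  assumes "1 \<le> p"
  shows "1 / 200 * (2 powr (- real p / 2) * real p powr (- 1 / 2)) \<le> rbit std_normal_distribution p"
proof (rule rbit_ge)
  fix \<nu> :: "real measure" assume \<nu>: "\<nu> \<in> random_bit_measures p"
  then have \<nu>2: "\<nu> \<in> second_moment_measures" using random_bit_measures_subset by blast
  define s t where "s = std_normal_quantile (1 / 4 / 2 ^ p)" and "t = std_normal_quantile (3 / 4 / 2 ^ p)"
  have N: "(2::real) \<le> 2 ^ p" using self_le_power[of "2::real" p] assms by simp
  then have in01: "1 / 4 / (2::real) ^ p < 1" "3 / 4 / (2::real) ^ p < 1"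
    by (auto simp: divide_simps)
  have st: "std_normal_cdf s = 1 / 4 / 2 ^ p" "std_normal_cdf t = 3 / 4 / 2 ^ p"
    unfolding s_def t_def using in01 by (intro std_normal_cdf_quantile; simp)+
  have gap: "1 / (50 * sqrt p) \<le> t - s"
    unfolding s_def t_def by (rule std_normal_quantile_tail_gap[OF assms])
  \<comment> \<open>With mass \<open>\<delta> = 1 / 2\<^sup>p\<close>, the squared gap is divided by \<open>16\<close>, which turns \<open>1 / 50\<close> into \<open>1 / 200\<close>.\<close>
  have scale: "(1 / 200 * (2 powr (- real p / 2) * real p powr (- 1 / 2)))\<^sup>2
      = (1 / (50 * sqrt p))\<^sup>2 * (1 / 2 ^ p) / 16"
    unfolding power_mult_distrib[of "1 / 200"] rate_square[OF assms]
    by (simp add: power_divide power_mult_distrib)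
  show "1 / 200 * (2 powr (- real p / 2) * real p powr (- 1 / 2)) \<le> wasserstein2 std_normal_distribution \<nu>"
  proof (rule wasserstein2_ge[OF std_normal_second_moment_measures \<nu>2])
    fix c assume "c \<in> coupling_costs TYPE(real \<times> real) std_normal_distribution \<nu>"
    then obtain M :: "(real \<times> real) measure" and X1 X2 where
      c: "c = sqrt (prob_space.expectation M (\<lambda>\<omega>. (norm (X1 \<omega> - X2 \<omega>))\<^sup>2))"
      and M: "prob_space M"
      and [measurable]: "X1 \<in> borel_measurable M" "X2 \<in> borel_measurable M"
      and d: "distr M borel X1 = std_normal_distribution" "distr M borel X2 = \<nu>"
      unfolding coupling_costs_def by blast
    have X1: "measure M {\<omega>\<in>space M. X1 \<omega> \<le> x} = std_normal_cdf x" for x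
      unfolding cdf_def d(1)[symmetric]
      by (subst measure_distr) (auto intro!: arg_cong[where f = "measure M"])
    have X2: "measure M {\<omega>\<in>space M. X2 \<omega> < (s + t) / 2} = measure \<nu> {..<(s + t) / 2}"
      unfolding d(2)[symmetric]
      by (subst measure_distr) (auto intro!: arg_cong[where f = "measure M"])
    have "(1 / 200 * (2 powr (- real p / 2) * real p powr (- 1 / 2)))\<^sup>2
        \<le> (t - s)\<^sup>2 * (1 / 2 ^ p) / 16"
      unfolding scale using gap by (intro divide_right_mono mult_right_mono power_mono) auto
    also have "\<dots> \<le> prob_space.expectation M (\<lambda>\<omega>. (X1 \<omega> - X2 \<omega>)\<^sup>2)"
    proof (rule quantized_coupling_lower_bound[OF M])
      show "integrable M (\<lambda>\<omega>. (X1 \<omega> - X2 \<omega>)\<^sup>2)"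
        using coupling_integrable[of X1 M X2] d \<nu>2 std_normal_second_moment_measures by simp
      have "0 \<le> 1 / (50 * sqrt p)" by simp
      then show "s \<le> t" using gap by linarith
      show "measure M {\<omega>\<in>space M. X2 \<omega> < (s + t) / 2} = 0
        \<or> 1 / 2 ^ p \<le> measure M {\<omega>\<in>space M. X2 \<omega> < (s + t) / 2}"
        unfolding X2 by (rule random_bit_measure_quantized[OF \<nu>]) simp
    qed (auto simp: X1 st)
    finally show "1 / 200 * (2 powr (- real p / 2) * real p powr (- 1 / 2)) \<le> c"
      unfolding c by (intro real_le_rsqrt) simp
  qed
qed

lemma expectation_rounding_error_le:
  assumes "1 \<le> p"
  shows "sqrt (\<integral>x. \<bar>x - bit_rounded_value p x\<bar>\<^sup>2 \<partial>std_normal_distribution)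
    \<le> 50 * (2 powr (- real p / 2) * real p powr (- 1 / 2))"
proof -
  have "(\<integral>x. \<bar>x - bit_rounded_value p x\<bar>\<^sup>2 \<partial>std_normal_distribution)
      = enn2real (\<integral>\<^sup>+x. ennreal ((x - bit_rounded_value p x)\<^sup>2) \<partial>std_normal_distribution)"
    by (subst integral_eq_nn_integral) auto
  also have "\<dots> \<le> enn2real (ennreal (2048 / (2 ^ p * real p)))"
    by (intro enn2real_mono nn_integral_rounding_error_le assms) simp
  also have "\<dots> = 2048 * (1 / 2 ^ p * (1 / real p))" by simp
  also have "\<dots> \<le> (50 * (2 powr (- real p / 2) * real p powr (- 1 / 2)))\<^sup>2"
    unfolding power_mult_distrib[of 50] rate_square[OF assms] by (intro mult_right_mono) auto
  finally show ?thesis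
    by (intro real_le_lsqrt) auto
qed

theorem theorem1:
  fixes M :: "'a measure" and Y :: "'a \<Rightarrow> real"
  assumes "prob_space M"
    and "distributed M lborel Y std_normal_density"
  shows
    "weakly_equiv_on {1..} (rbit std_normal_distribution)
       (\<lambda>p. 2 powr (- real p / 2) * real p powr (- 1 / 2)) \<and>
     weakly_equiv_on {1..}
       (\<lambda>p. sqrt (prob_space.expectation M (\<lambda>\<omega>. \<bar>Y \<omega> - bit_approx p Y \<omega>\<bar>\<^sup>2)))
       (rbit std_normal_distribution) \<and>
     (\<forall>p\<ge>1. integrable M (bit_approx p Y) \<and> prob_space.expectation M (bit_approx p Y) = 0) \<and>
     (\<forall>r::real. r \<ge> 1 \<longrightarrow>
       (SUP p\<in>{1..}. \<integral>\<^sup>+\<omega>. ennreal (\<bar>bit_approx p Y \<omega>\<bar> powr r) \<partial>M) < \<infinity>)"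
proof -
  let ?rate = "\<lambda>p. 2 powr (- real p / 2) * real p powr (- 1 / 2)"
  let ?err = "\<lambda>p. sqrt (prob_space.expectation M (\<lambda>\<omega>. \<bar>Y \<omega> - bit_approx p Y \<omega>\<bar>\<^sup>2))"
  let ?rbit = "rbit std_normal_distribution"
  have [measurable]: "Y \<in> borel_measurable M"
    using distributed_measurable[OF assms(2)] by simp
  have law: "distr M borel Y = std_normal_distribution"
    using distributed_distr_eq_density[OF assms(2)]
    by (simp add: distr_cong[OF refl sets_lborel[symmetric] refl])
  have approx: "bit_approx p Y = (\<lambda>\<omega>. bit_rounded_value p (Y \<omega>))" for p
    by (rule ext) (rule bit_approx_eq)
  have err: "?err p = sqrt (\<integral>x. \<bar>x - bit_rounded_value p x\<bar>\<^sup>2 \<partial>std_normal_distribution)" for p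
    unfolding approx by (subst law[symmetric], subst integral_distr) auto
  have upper: "?err p \<le> 50 * ?rate p" if "p \<in> {1..}" for p
    unfolding err using that by (intro expectation_rounding_error_le) simp
  have lower: "?rate p \<le> 200 * ?rbit p" if "p \<in> {1..}" for p
    using rbit_std_normal_ge[of p] that by simp
  have optimal: "?rbit p \<le> 1 * ?err p" for p
  proof -
    have "distr M borel (bit_approx p Y) = distr (distr M borel Y) borel (bit_rounded_value p)"
      unfolding approx by (subst distr_distr) (auto simp: comp_def)
    then have bits: "distr M borel (bit_approx p Y) \<in> random_bit_measures p"
      unfolding law using bit_rounded_value_distr_random_bits by simp
    have "?rbit p \<le> wasserstein2 std_normal_distribution (distr M borel (bit_approx p Y))"
      by (rule rbit_le_wasserstein2[OF std_normal_second_moment_measures bits])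
    also have "\<dots> \<le> sqrt (prob_space.expectation M (\<lambda>\<omega>. (norm (Y \<omega> - bit_approx p Y \<omega>))\<^sup>2))"
      by (rule wasserstein2_le_coupling[OF assms(1) _ _ law refl]) (simp_all add: approx)
    finally show ?thesis by simp
  qed
  have rbit_rate: "?rbit p \<le> 50 * ?rate p" if "p \<in> {1..}" for p
    using optimal[of p] upper[OF that] by linarith
  have err_rbit: "?err p \<le> 10000 * ?rbit p" if "p \<in> {1..}" for p
    using upper[OF that] lower[OF that] by linarith
  have preceq: "preceq_on {1..} f g" if "0 < c" "\<And>p. p \<in> {1..} \<Longrightarrow> f p \<le> c * g p"
    for c and f g :: "nat \<Rightarrow> real"
    unfolding preceq_on_def using that by blast
  have mean: "integrable M (bit_approx p Y) \<and> prob_space.expectation M (bit_approx p Y) = 0" for p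
  proof
    show "integrable M (bit_approx p Y)"
      using expectation_bit_rounded_value(1)[of p] unfolding law[symmetric] approx
      by (simp add: integrable_distr_eq)
    have "prob_space.expectation M (bit_approx p Y) = (\<integral>x. bit_rounded_value p x \<partial>distr M borel Y)"
      unfolding approx by (subst integral_distr) auto
    then show "prob_space.expectation M (bit_approx p Y) = 0"
      unfolding law by (simp add: expectation_bit_rounded_value(2))
  qed
  have moment: "(SUP p\<in>{1..}. \<integral>\<^sup>+\<omega>. ennreal (\<bar>bit_approx p Y \<omega>\<bar> powr r) \<partial>M) < \<infinity>"
    if "1 \<le> r" for r :: real
  proof -
    have "(\<integral>\<^sup>+\<omega>. ennreal (\<bar>bit_approx p Y \<omega>\<bar> powr r) \<partial>M) \<le> ennreal (4 * exp (r\<^sup>2))" for p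
    proof -
      have "(\<integral>\<^sup>+\<omega>. ennreal (\<bar>bit_approx p Y \<omega>\<bar> powr r) \<partial>M)
          = (\<integral>\<^sup>+x. ennreal (\<bar>bit_rounded_value p x\<bar> powr r) \<partial>distr M borel Y)"
        unfolding approx by (subst nn_integral_distr) auto
      also have "\<dots> \<le> ennreal (4 * exp (r\<^sup>2))"
        unfolding law using that by (intro nn_integral_bit_rounded_value_powr_le) simp
      finally show ?thesis .
    qed
    then have "(SUP p\<in>{1..}. \<integral>\<^sup>+\<omega>. ennreal (\<bar>bit_approx p Y \<omega>\<bar> powr r) \<partial>M) \<le> ennreal (4 * exp (r\<^sup>2))"
      by (intro SUP_least)
    also have "\<dots> < \<infinity>" by simp
    finally show ?thesis .
  qed
  show ?thesis
    unfolding weakly_equiv_on_def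
  proof (intro conjI allI impI)
    show "preceq_on {1..} ?rbit ?rate" by (rule preceq[OF _ rbit_rate]) simp
    show "preceq_on {1..} ?rate ?rbit" by (rule preceq[OF _ lower]) simp
    show "preceq_on {1..} ?err ?rbit" by (rule preceq[OF _ err_rbit]) simp
    show "preceq_on {1..} ?rbit ?err" by (rule preceq[OF _ optimal]) simp
  qed (use mean moment in auto)
qed

end
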